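(* Let $t$, $u$ be two terms of type $A$ in context $\Gamma$ of $\mathrm{IK}_C$. If for all Cartesian closed categories $\mathcal{M}$ equipped with an adjunction it is the case that $[\![t]\!] = [\![u]\!] : \mathcal{M}([\![\Gamma]\!],[\![A]\!])$, then $t \equiv u$ in context $\Gamma$ at type $A$.
   Context: $\mathrm{IK}_C$ is the Fitch-style calculus with types $A ::= \iota\mid A\to B\mid\Box A$ and contexts $\Gamma::=\cdot\mid\Gamma,A\mid\Gamma,\mathsf{lock}$ ($\mathsf{lock}$ the context lock); $\Delta\mathrel{R}\Gamma$ holds when $\Gamma=\Delta,\mathsf{lock},\Delta'$ with $\Delta'$ lock-free. Terms: STLC plus $\mathsf{box}\,t:\Box A$ in $\Gamma$ from $t:A$ in $\Gamma,\mathsf{lock}$, and $\mathsf{unbox}(t,e):A$ in $\Gamma$ from $t:\Box A$ in $\Delta$ and $e:\Delta\mathrel{R}\Gamma$. Equational theory: function $\beta,\eta$; $\mathsf{unbox}(\mathsf{box}\,t,e)\equiv\mathit{wk}(\mathit{factor}(e),t)$; $t\equiv\mathsf{box}(\mathsf{unbox}(t,\mathit{nil}))$. Terms are interpreted in a CCC with an adjunction $\mathsf{lock}\dashv\Box$ by interpreting $\Box$, $\mathsf{lock}$ as right/left adjoint and $\mathsf{box}$/$\mathsf{unbox}$ via the adjuncts (Clouston's semantics). *)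

theory Defs
  imports Main
begin

section \<open>Syntax of IK_C (de Bruijn, contexts as snoc-lists: head = rightmost entry)\<close>

datatype ty = Iota | Arr ty ty | Box ty

datatype ctxe = CTy ty | Lock

type_synonym ctx = "ctxe list"

text \<open>Variables are de Bruijn positions into the context (counting locks);
  a variable may not be looked up across a lock.
  \<open>Unbox t k\<close>: the witness e : Delta R Gamma is represented by k = length of the
  lock-free suffix Delta'; so Gamma ! k = Lock and Delta = drop (Suc k) Gamma.\<close>

datatype tm = Var nat | Lam ty tm | App tm tm | BoxI tm | Unbox tm nat

fun lookup :: "ctx \<Rightarrow> nat \<Rightarrow> ty option" where
  "lookup (CTy A # G) 0 = Some A"
| "lookup (CTy A # G) (Suc n) = lookup G n"
| "lookup _ _ = None"

definition lockext :: "ctx \<Rightarrow> nat \<Rightarrow> bool" where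
  "lockext G k \<longleftrightarrow> k < length G \<and> G ! k = Lock \<and> (\<forall>i<k. G ! i \<noteq> Lock)"

inductive typed :: "ctx \<Rightarrow> tm \<Rightarrow> ty \<Rightarrow> bool" where
  t_var: "lookup G n = Some A \<Longrightarrow> typed G (Var n) A"
| t_lam: "typed (CTy A # G) t B \<Longrightarrow> typed G (Lam A t) (Arr A B)"
| t_app: "typed G t (Arr A B) \<Longrightarrow> typed G u A \<Longrightarrow> typed G (App t u) B"
| t_box: "typed (Lock # G) t A \<Longrightarrow> typed G (BoxI t) (Box A)"
| t_unbox: "lockext G k \<Longrightarrow> typed (drop (Suc k) G) t (Box A) \<Longrightarrow> typed G (Unbox t k) A"

fun shift :: "nat \<Rightarrow> nat \<Rightarrow> tm \<Rightarrow> tm" where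
  "shift m c (Var n) = (if n < c then Var n else Var (n + m))"
| "shift m c (Lam A t) = Lam A (shift m (Suc c) t)"
| "shift m c (App t u) = App (shift m c t) (shift m c u)"
| "shift m c (BoxI t) = BoxI (shift m (Suc c) t)"
| "shift m c (Unbox t k) =
     (if c \<le> k then Unbox t (k + m) else Unbox (shift m (c - Suc k) t) k)"

text \<open>Substitution of u (living in the context below position c) for the variable at position c.\<close>
fun subst :: "nat \<Rightarrow> tm \<Rightarrow> tm \<Rightarrow> tm" where
  "subst c u (Var n) = (if n < c then Var n else if n = c then shift c 0 u else Var (n - 1))"
| "subst c u (Lam A t) = Lam A (subst (Suc c) u t)"
| "subst c u (App t t') = App (subst c u t) (subst c u t')"
| "subst c u (BoxI t) = BoxI (subst (Suc c) u t)"
| "subst c u (Unbox t k) =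
     (if c < k then Unbox t (k - 1) else Unbox (subst (c - Suc k) u t) k)"

text \<open>Equational theory (typed): congruence closure of beta/eta for functions and boxes.
  wk(factor(e), t) is the weakening \<open>shift k 0 t\<close> from Delta,lock to Gamma = Delta,lock,Delta'.\<close>
inductive eqv :: "ctx \<Rightarrow> tm \<Rightarrow> tm \<Rightarrow> ty \<Rightarrow> bool" where
  e_refl: "typed G t A \<Longrightarrow> eqv G t t A"
| e_sym: "eqv G t u A \<Longrightarrow> eqv G u t A"
| e_trans: "eqv G t u A \<Longrightarrow> eqv G u v A \<Longrightarrow> eqv G t v A"
| e_lam: "eqv (CTy A # G) t t' B \<Longrightarrow> eqv G (Lam A t) (Lam A t') (Arr A B)"
| e_app: "eqv G t t' (Arr A B) \<Longrightarrow> eqv G u u' A \<Longrightarrow> eqv G (App t u) (App t' u') B"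
| e_box: "eqv (Lock # G) t t' A \<Longrightarrow> eqv G (BoxI t) (BoxI t') (Box A)"
| e_unbox: "lockext G k \<Longrightarrow> eqv (drop (Suc k) G) t t' (Box A) \<Longrightarrow> eqv G (Unbox t k) (Unbox t' k) A"
| e_beta: "typed (CTy A # G) t B \<Longrightarrow> typed G u A \<Longrightarrow> eqv G (App (Lam A t) u) (subst 0 u t) B"
| e_eta: "typed G t (Arr A B) \<Longrightarrow> eqv G t (Lam A (App (shift 1 0 t) (Var 0))) (Arr A B)"
| e_boxbeta: "lockext G k \<Longrightarrow> typed (Lock # drop (Suc k) G) t A \<Longrightarrow>
              eqv G (Unbox (BoxI t) k) (shift k 0 t) A"
| e_boxeta: "typed G t (Box A) \<Longrightarrow> eqv G t (BoxI (Unbox t 0)) (Box A)"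

record ('o, 'a) cccadj =
  c_ob :: "'o set"
  c_hom :: "'o \<Rightarrow> 'o \<Rightarrow> 'a set"
  c_comp :: "'a \<Rightarrow> 'a \<Rightarrow> 'a"   \<comment> \<open>c_comp g f = g o f\<close>
  c_id :: "'o \<Rightarrow> 'a"
  c_term :: "'o"
  c_bang :: "'o \<Rightarrow> 'a"
  c_prod :: "'o \<Rightarrow> 'o \<Rightarrow> 'o"
  c_pi1 :: "'o \<Rightarrow> 'o \<Rightarrow> 'a"
  c_pi2 :: "'o \<Rightarrow> 'o \<Rightarrow> 'a"
  c_pair :: "'a \<Rightarrow> 'a \<Rightarrow> 'a"
  c_exp :: "'o \<Rightarrow> 'o \<Rightarrow> 'o"   \<comment> \<open>c_exp A B = B^A\<close>
  c_ev :: "'o \<Rightarrow> 'o \<Rightarrow> 'a"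
  c_curry :: "'o \<Rightarrow> 'o \<Rightarrow> 'o \<Rightarrow> 'a \<Rightarrow> 'a"  \<comment> \<open>C x A -> B  to  C -> B^A\<close>
  c_lko :: "'o \<Rightarrow> 'o"   \<comment> \<open>left adjoint (lock) on objects\<close>
  c_lka :: "'a \<Rightarrow> 'a"
  c_bxo :: "'o \<Rightarrow> 'o"   \<comment> \<open>right adjoint (box) on objects\<close>
  c_bxa :: "'a \<Rightarrow> 'a"
  c_unit :: "'o \<Rightarrow> 'a"
  c_counit :: "'o \<Rightarrow> 'a"

definition is_cccadj :: "('o, 'a) cccadj \<Rightarrow> bool" where
  "is_cccadj M \<longleftrightarrow>
   (let Ob = c_ob M; H = c_hom M; cmp = c_comp M; idm = c_id M in
    \<comment> \<open>category\<close>
    (\<forall>X\<in>Ob. idm X \<in> H X X) \<and>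
    (\<forall>X\<in>Ob. \<forall>Y\<in>Ob. \<forall>Z\<in>Ob. \<forall>f\<in>H X Y. \<forall>g\<in>H Y Z. cmp g f \<in> H X Z) \<and>
    (\<forall>X\<in>Ob. \<forall>Y\<in>Ob. \<forall>f\<in>H X Y. cmp (idm Y) f = f \<and> cmp f (idm X) = f) \<and>
    (\<forall>W\<in>Ob. \<forall>X\<in>Ob. \<forall>Y\<in>Ob. \<forall>Z\<in>Ob. \<forall>f\<in>H W X. \<forall>g\<in>H X Y. \<forall>h\<in>H Y Z.
        cmp h (cmp g f) = cmp (cmp h g) f) \<and>
    \<comment> \<open>terminal object\<close>
    c_term M \<in> Ob \<and>
    (\<forall>X\<in>Ob. c_bang M X \<in> H X (c_term M) \<and> (\<forall>f\<in>H X (c_term M). f = c_bang M X)) \<and>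
    \<comment> \<open>binary products\<close>
    (\<forall>A\<in>Ob. \<forall>B\<in>Ob. c_prod M A B \<in> Ob \<and>
        c_pi1 M A B \<in> H (c_prod M A B) A \<and> c_pi2 M A B \<in> H (c_prod M A B) B \<and>
        (\<forall>C\<in>Ob. \<forall>f\<in>H C A. \<forall>g\<in>H C B. c_pair M f g \<in> H C (c_prod M A B) \<and>
            cmp (c_pi1 M A B) (c_pair M f g) = f \<and> cmp (c_pi2 M A B) (c_pair M f g) = g) \<and>
        (\<forall>C\<in>Ob. \<forall>h\<in>H C (c_prod M A B).
            c_pair M (cmp (c_pi1 M A B) h) (cmp (c_pi2 M A B) h) = h)) \<and>
    \<comment> \<open>exponentials\<close>
    (\<forall>A\<in>Ob. \<forall>B\<in>Ob. c_exp M A B \<in> Ob \<and>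
        c_ev M A B \<in> H (c_prod M (c_exp M A B) A) B \<and>
        (\<forall>C\<in>Ob. \<forall>f\<in>H (c_prod M C A) B. c_curry M C A B f \<in> H C (c_exp M A B) \<and>
            cmp (c_ev M A B) (c_pair M (cmp (c_curry M C A B f) (c_pi1 M C A)) (c_pi2 M C A)) = f) \<and>
        (\<forall>C\<in>Ob. \<forall>g\<in>H C (c_exp M A B).
            c_curry M C A B (cmp (c_ev M A B) (c_pair M (cmp g (c_pi1 M C A)) (c_pi2 M C A))) = g)) \<and>
    \<comment> \<open>the two functors\<close>
    (\<forall>X\<in>Ob. c_lko M X \<in> Ob \<and> c_bxo M X \<in> Ob \<and>
        c_lka M (idm X) = idm (c_lko M X) \<and> c_bxa M (idm X) = idm (c_bxo M X)) \<and>
    (\<forall>X\<in>Ob. \<forall>Y\<in>Ob. \<forall>f\<in>H X Y. c_lka M f \<in> H (c_lko M X) (c_lko M Y) \<and>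
        c_bxa M f \<in> H (c_bxo M X) (c_bxo M Y)) \<and>
    (\<forall>X\<in>Ob. \<forall>Y\<in>Ob. \<forall>Z\<in>Ob. \<forall>f\<in>H X Y. \<forall>g\<in>H Y Z.
        c_lka M (cmp g f) = cmp (c_lka M g) (c_lka M f) \<and>
        c_bxa M (cmp g f) = cmp (c_bxa M g) (c_bxa M f)) \<and>
    \<comment> \<open>adjunction lock -| box via unit and counit\<close>
    (\<forall>X\<in>Ob. c_unit M X \<in> H X (c_bxo M (c_lko M X)) \<and>
        c_counit M X \<in> H (c_lko M (c_bxo M X)) X) \<and>
    (\<forall>X\<in>Ob. \<forall>Y\<in>Ob. \<forall>f\<in>H X Y.
        cmp (c_unit M Y) f = cmp (c_bxa M (c_lka M f)) (c_unit M X) \<and>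
        cmp (c_counit M Y) (c_lka M (c_bxa M f)) = cmp f (c_counit M X)) \<and>
    (\<forall>X\<in>Ob. cmp (c_counit M (c_lko M X)) (c_lka M (c_unit M X)) = idm (c_lko M X) \<and>
        cmp (c_bxa M (c_counit M X)) (c_unit M (c_bxo M X)) = idm (c_bxo M X)))"

section \<open>Interpretation (Clouston's semantics); b interprets the base type\<close>

fun ity :: "('o, 'a) cccadj \<Rightarrow> 'o \<Rightarrow> ty \<Rightarrow> 'o" where
  "ity M b Iota = b"
| "ity M b (Arr A B) = c_exp M (ity M b A) (ity M b B)"
| "ity M b (Box A) = c_bxo M (ity M b A)"

fun ictx :: "('o, 'a) cccadj \<Rightarrow> 'o \<Rightarrow> ctx \<Rightarrow> 'o" where
  "ictx M b [] = c_term M"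
| "ictx M b (CTy A # G) = c_prod M (ictx M b G) (ity M b A)"
| "ictx M b (Lock # G) = c_lko M (ictx M b G)"

text \<open>Type inference (terms are Church-style, types are unique); used to recover the
  objects needed in the interpretation.\<close>
fun infer :: "ctx \<Rightarrow> tm \<Rightarrow> ty option" where
  "infer G (Var n) = lookup G n"
| "infer G (Lam A t) = map_option (Arr A) (infer (CTy A # G) t)"
| "infer G (App t u) = (case infer G t of
      Some (Arr A B) \<Rightarrow> (if infer G u = Some A then Some B else None) | _ \<Rightarrow> None)"
| "infer G (BoxI t) = map_option Box (infer (Lock # G) t)"
| "infer G (Unbox t k) = (if lockext G k then
      (case infer (drop (Suc k) G) t of Some (Box A) \<Rightarrow> Some A | _ \<Rightarrow> None) else None)"

fun ivar :: "('o, 'a) cccadj \<Rightarrow> 'o \<Rightarrow> ctx \<Rightarrow> nat \<Rightarrow> 'a" where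
  "ivar M b (CTy A # G) 0 = c_pi2 M (ictx M b G) (ity M b A)"
| "ivar M b (CTy A # G) (Suc n) = c_comp M (ivar M b G n) (c_pi1 M (ictx M b G) (ity M b A))"
| "ivar M b G n = undefined"

text \<open>Interpretation of the extension e : Delta R Gamma as an arrow [Gamma] -> Lock [Delta].\<close>
fun iext :: "('o, 'a) cccadj \<Rightarrow> 'o \<Rightarrow> ctx \<Rightarrow> nat \<Rightarrow> 'a" where
  "iext M b (Lock # G) 0 = c_id M (c_lko M (ictx M b G))"
| "iext M b (CTy A # G) (Suc k) = c_comp M (iext M b G k) (c_pi1 M (ictx M b G) (ity M b A))"
| "iext M b G k = undefined"

fun itm :: "('o, 'a) cccadj \<Rightarrow> 'o \<Rightarrow> ctx \<Rightarrow> tm \<Rightarrow> 'a" where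
  "itm M b G (Var n) = ivar M b G n"
| "itm M b G (Lam A t) =
     c_curry M (ictx M b G) (ity M b A) (ity M b (the (infer (CTy A # G) t)))
       (itm M b (CTy A # G) t)"
| "itm M b G (App t u) = (case infer G t of
      Some (Arr A B) \<Rightarrow> c_comp M (c_ev M (ity M b A) (ity M b B)) (c_pair M (itm M b G t) (itm M b G u))
    | _ \<Rightarrow> undefined)"
| "itm M b G (BoxI t) = c_comp M (c_bxa M (itm M b (Lock # G) t)) (c_unit M (ictx M b G))"
| "itm M b G (Unbox t k) = (case infer (drop (Suc k) G) t of
      Some (Box A) \<Rightarrow> c_comp M (c_comp M (c_counit M (ity M b A)) (c_lka M (itm M b (drop (Suc k) G) t)))
                         (iext M b G k)
    | _ \<Rightarrow> undefined)"

end

theory Submission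
  imports Defs "HOL-Library.Countable"
begin

text \<open>Normalization by evaluation, organised as a countable CCC with adjunction. The underlying
  semantics lives in presheaves over contexts and weakenings, where \<open>lock\<close> sends \<open>X\<close> to
  \<open>G \<mapsto> X(D)\<close> with \<open>D\<close> the part of \<open>G\<close> before its last lock (and to the empty set if \<open>G\<close> has no
  lock), its right adjoint sends \<open>X\<close> to \<open>G \<mapsto> X(G,lock)\<close>, and the base type denotes terms
  modulo \<open>eqv\<close>. To keep exponentials inside one countable type, values are first-order closures
  over categorical combinators, and objects denote families of partial equivalence relations on
  values; an arrow is a combinator modulo extensional equality. Equality in this model makes the
  readbacks of the values of \<open>t\<close> and \<open>u\<close> at the identity environment equivalent, and a Kripke
  logical relation between terms and values shows that every term is equivalent to the readback
  of its value.\<close>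

section \<open>Weakening\<close>

lemma lockext_simps [simp]:
  "\<not> lockext [] k"
  "lockext (x # G) 0 \<longleftrightarrow> x = Lock"
  "lockext (x # G) (Suc k) \<longleftrightarrow> x \<noteq> Lock \<and> lockext G k"
  by (auto simp: lockext_def less_Suc_eq_0_disj)

text \<open>The indices are the arguments of \<open>shift\<close>: a block of \<open>m\<close>
  entries goes in below the \<open>c\<close> rightmost ones. Keeping the block lock-free preserves
  which variables and which lock a term can reach.\<close>

inductive wk :: "nat \<Rightarrow> nat \<Rightarrow> ctx \<Rightarrow> ctx \<Rightarrow> bool" where
  wk_0: "Lock \<notin> set E \<Longrightarrow> wk (length E) 0 G (E @ G)"
| wk_Suc: "wk m c G D \<Longrightarrow> wk m (Suc c) (x # G) (x # D)"

lemma lookup_append: "Lock \<notin> set E \<Longrightarrow> lookup (E @ G) (n + length E) = lookup G n"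
proof (induction E)
  case (Cons x E)
  then show ?case by (cases x) auto
qed simp

lemma lookup_wk:
  "wk m c G D \<Longrightarrow> lookup G n = Some A \<Longrightarrow> lookup D (if n < c then n else n + m) = Some A"
proof (induction arbitrary: n rule: wk.induct)
  case (wk_0 E G)
  then show ?case by (simp add: lookup_append)
next
  case (wk_Suc m c G D x)
  from wk_Suc.IH[of "n - 1"] wk_Suc.prems show ?case
    by (cases x; cases n) (auto split: if_splits)
qed

lemma lockext_append: "Lock \<notin> set E \<Longrightarrow> lockext (E @ G) (k + length E) \<longleftrightarrow> lockext G k"
  by (induction E) auto

lemma lockext_wk_le:
  "wk m c G D \<Longrightarrow> lockext G k \<Longrightarrow> c \<le> k \<Longrightarrow>
    lockext D (k + m) \<and> drop (Suc (k + m)) D = drop (Suc k) G"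
proof (induction arbitrary: k rule: wk.induct)
  case (wk_0 E G)
  then show ?case by (simp add: lockext_append)
next
  case (wk_Suc m c G D x)
  then show ?case by (cases k) auto
qed

lemma lockext_wk_gt:
  "wk m c G D \<Longrightarrow> lockext G k \<Longrightarrow> k < c \<Longrightarrow>
    lockext D k \<and> wk m (c - Suc k) (drop (Suc k) G) (drop (Suc k) D)"
proof (induction arbitrary: k rule: wk.induct)
  case (wk_Suc m c G D x)
  then show ?case by (cases k) auto
qed simp

lemma wk_CTy: "wk (Suc 0) 0 G (CTy A # G)"
  using wk_0[of "[CTy A]" G] by simp

text \<open>The factorisation of an extension: all entries above the last lock form one lock-free
  block, inserted directly after that lock.\<close>

lemma wk_lockext: "lockext G k \<Longrightarrow> wk k 0 (Lock # drop (Suc k) G) G"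
proof -
  assume k: "lockext G k"
  then have len: "k < length G" and eq: "G = take k G @ Lock # drop (Suc k) G"
    by (auto simp: lockext_def) (metis id_take_nth_drop)
  have "Lock \<notin> set (take k G)"
    using k by (auto simp: lockext_def in_set_conv_nth)
  from wk_0[OF this, of "Lock # drop (Suc k) G"] len eq show ?thesis by simp
qed

section \<open>Commutation laws of shifting and substitution\<close>

lemma shift_0 [simp]: "shift 0 c t = t"
  by (induction t arbitrary: c) auto

text \<open>The second insertion falls inside the first block or at its edge, so together they
  insert one longer block.\<close>

lemma shift_fuse: "d \<le> c \<Longrightarrow> c \<le> d + k \<Longrightarrow> shift m c (shift k d t) = shift (k + m) d t"
proof (induction t arbitrary: c d)
  case (Unbox t j)
  show ?case
  proof (cases "d \<le> j")
    case True
    then show ?thesis using Unbox.prems by simp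
  next
    case False
    then have "d - Suc j \<le> c - Suc j" "c - Suc j \<le> d - Suc j + k" using Unbox.prems by auto
    from Unbox.IH[OF this] show ?thesis using Unbox.prems False by simp
  qed
qed simp_all

lemma shift_commute: "d \<le> c \<Longrightarrow> shift m (c + k) (shift k d t) = shift k d (shift m c t)"
proof (induction t arbitrary: c d)
  case (Lam A t)
  from Lam.IH[of "Suc d" "Suc c"] Lam.prems show ?case by simp
next
  case (BoxI t)
  from BoxI.IH[of "Suc d" "Suc c"] BoxI.prems show ?case by simp
next
  case (Unbox t j)
  consider "c \<le> j" | "d \<le> j" "j < c" | "j < d" by linarith
  then show ?case
  proof cases
    case 3
    then obtain d' c' where "d = Suc (j + d')" "c = Suc (j + c')"
      using Unbox.prems by (metis less_iff_Suc_add order_less_le_trans)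
    with Unbox.IH[of d' c'] Unbox.prems show ?thesis by simp
  qed (use Unbox.prems in auto)
qed simp_all

lemma shift_commute_1: "shift m (Suc c) (shift (Suc 0) 0 t) = shift (Suc 0) 0 (shift m c t)"
  using shift_commute[of 0 c m "Suc 0" t] by simp

lemma subst_shift_cancel: "subst c u (shift (Suc 0) c t) = t"
  by (induction t arbitrary: c) auto

lemma subst_shift: "d \<le> c \<Longrightarrow> subst (c + m) u (shift m d t) = shift m d (subst c u t)"
proof (induction t arbitrary: c d)
  case (Var n)
  consider "n < d" | "d \<le> n" "n < c" | "n = c" | "c < n" by linarith
  then show ?case
    by cases (use Var in \<open>auto simp: shift_fuse\<close>)
next
  case (Lam A t)
  from Lam.IH[of "Suc d" "Suc c"] Lam.prems show ?case by simp
next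
  case (BoxI t)
  from BoxI.IH[of "Suc d" "Suc c"] BoxI.prems show ?case by simp
next
  case (Unbox t j)
  consider "c < j" | "d \<le> j" "j \<le> c" | "j < d" by linarith
  then show ?case
  proof cases
    case 3
    then obtain d' c' where "d = Suc (j + d')" "c = Suc (j + c')"
      using Unbox.prems by (metis less_iff_Suc_add order_less_le_trans)
    with Unbox.IH[of d' c'] Unbox.prems show ?thesis by simp
  qed (use Unbox.prems in auto)
qed simp_all

text \<open>False for arbitrary terms: when position \<open>d\<close> is a lock reached by an \<open>Unbox\<close>, shifting and
  substitution disagree on it.\<close>

lemma shift_subst:
  "typed G t B \<Longrightarrow> G ! d = CTy A \<Longrightarrow>
    shift m (c + d) (subst d u t) = subst d (shift m c u) (shift m (Suc (c + d)) t)"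
proof (induction arbitrary: d rule: typed.induct)
  case (t_var G n B)
  consider "n < d" | "n = d" | "d < n" "n \<le> c + d" | "c + d < n" by linarith
  then show ?case
    by cases (auto simp: shift_commute)
next
  case (t_lam A G t B)
  from t_lam.IH[of "Suc d"] t_lam.prems show ?case by simp
next
  case (t_box G t B)
  from t_box.IH[of "Suc d"] t_box.prems show ?case by simp
next
  case (t_unbox G j t B)
  then have "j \<noteq> d" "j < length G" by (auto simp: lockext_def)
  then consider "j < d" | "d < j" "j \<le> c + d" | "c + d < j" by linarith
  then show ?case
  proof cases
    case 1
    then obtain d' where "d = Suc (j + d')" by (metis less_iff_Suc_add)
    with t_unbox.IH[of d'] t_unbox.prems \<open>j < length G\<close> show ?thesis by (simp add: algebra_simps)
  qed auto
qed simp

section \<open>Typing and equivalence under weakening\<close>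

lemma typed_wk: "typed G t A \<Longrightarrow> wk m c G D \<Longrightarrow> typed D (shift m c t) A"
proof (induction arbitrary: c D rule: typed.induct)
  case (t_var G n A)
  from lookup_wk[OF t_var(2,1)] show ?case
    by (auto intro: typed.t_var split: if_splits)
next
  case (t_unbox G k t A)
  show ?case
  proof (cases "c \<le> k")
    case True
    with lockext_wk_le[OF t_unbox.prems t_unbox.hyps(1)] t_unbox.hyps(2) show ?thesis
      by (auto intro!: typed.t_unbox)
  next
    case False
    with lockext_wk_gt[OF t_unbox.prems t_unbox.hyps(1)] t_unbox.IH show ?thesis
      by (auto intro!: typed.t_unbox)
  qed
qed (fastforce intro: typed.intros wk_Suc)+

text \<open>Makes terms modulo \<open>eqv\<close> a presheaf over weakenings, as the base type
  requires. The beta case is \<open>shift_subst\<close> at the bound variable; the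
  \<open>Unbox\<close> cases split on the side of the lock at which entries are inserted.\<close>

lemma eqv_wk: "eqv G t u A \<Longrightarrow> wk m c G D \<Longrightarrow> eqv D (shift m c t) (shift m c u) A"
proof (induction arbitrary: c D rule: eqv.induct)
  case (e_refl G t A)
  then show ?case by (blast intro: eqv.e_refl typed_wk)
next
  case (e_sym G t u A)
  then show ?case by (blast intro: eqv.e_sym)
next
  case (e_trans G t u A v)
  then show ?case by (blast intro: eqv.e_trans)
next
  case (e_unbox G k t t' A)
  show ?case
  proof (cases "c \<le> k")
    case True
    with lockext_wk_le[OF e_unbox.prems e_unbox.hyps(1)] e_unbox.hyps(2) show ?thesis
      by (auto intro!: eqv.e_unbox)
  next
    case False
    with lockext_wk_gt[OF e_unbox.prems e_unbox.hyps(1)] e_unbox.IH show ?thesis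
      by (auto intro!: eqv.e_unbox)
  qed
next
  case (e_beta A G t B u)
  have "eqv D (App (Lam A (shift m (Suc c) t)) (shift m c u))
      (subst 0 (shift m c u) (shift m (Suc c) t)) B"
    by (intro eqv.e_beta typed_wk[OF e_beta.hyps(1)] typed_wk[OF e_beta.hyps(2)] wk_Suc e_beta.prems)
  with shift_subst[OF e_beta.hyps(1), of 0 A m c u] show ?case by simp
next
  case (e_eta G t A B)
  from eqv.e_eta[OF typed_wk[OF e_eta]] show ?case
    by (simp add: shift_commute_1)
next
  case (e_boxbeta G k t A)
  show ?case
  proof (cases "c \<le> k")
    case True
    with lockext_wk_le[OF e_boxbeta.prems e_boxbeta.hyps(1)] e_boxbeta.hyps(2)
    have "eqv D (Unbox (BoxI t) (k + m)) (shift (k + m) 0 t) A"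
      by (intro eqv.e_boxbeta) auto
    with True show ?thesis by (simp add: shift_fuse)
  next
    case False
    note w = lockext_wk_gt[OF e_boxbeta.prems e_boxbeta.hyps(1)]
    \<comment> \<open>The body of the box has its own lock at position 0, hence the additional
      \<open>Suc\<close> around \<open>c - Suc k\<close>.\<close>
    from False w have "wk m (Suc (c - Suc k)) (Lock # drop (Suc k) G) (Lock # drop (Suc k) D)"
      by (auto intro: wk_Suc)
    from typed_wk[OF e_boxbeta.hyps(2) this] w False
    have "eqv D (Unbox (BoxI (shift m (Suc (c - Suc k)) t)) k) (shift k 0 (shift m (Suc (c - Suc k)) t)) A"
      by (intro eqv.e_boxbeta) auto
    moreover have "shift m c (shift k 0 t) = shift k 0 (shift m (Suc (c - Suc k)) t)"
      using False shift_commute[of 0 "c - k" m k t] by (simp add: Suc_diff_Suc)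
    ultimately show ?thesis using False by simp
  qed
next
  case (e_boxeta G t A)
  from eqv.e_boxeta[OF typed_wk[OF e_boxeta]] show ?case by simp
qed (fastforce intro: eqv.e_lam eqv.e_app eqv.e_box wk_Suc)+

section \<open>Combinators, values and evaluation\<close>

datatype ob = OBase | OUnit | OProd ob ob | OExp ob ob | OLock ob | OBox ob

text \<open>Combinators carry no objects; sources and targets are supplied by \<open>eqp\<close> and
  \<open>arrow\<close>.\<close>

datatype prog = PId | PComp prog prog | PBang | PFst | PSnd | PPair prog prog
  | PEv | PCurry prog | PLock prog | PBox prog | PUnit | PCounit

instance ob :: countable by countable_datatype
instance prog :: countable by countable_datatype

text \<open>A value of a lock object in context \<open>G\<close> records the position \<open>k\<close> of the last lock of \<open>G\<close>
  and a value in \<open>drop (Suc k) G\<close>; a value of a box object in \<open>G\<close> is a value in \<open>Lock # G\<close>.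
  \<open>VNe A B t\<close> is a term of type \<open>Arr A B\<close> regarded as a function value.\<close>

datatype val = VTm tm | VUnit | VPair val val | VClo prog val | VNe ty ty tm
  | VLock nat val | VBox val

text \<open>A closure is weakened through its environment alone, since its combinator is closed. The
  clause for \<open>VLock\<close> parallels that of \<open>shift\<close> for
  \<open>Unbox\<close>.\<close>

fun vshift :: "nat \<Rightarrow> nat \<Rightarrow> val \<Rightarrow> val" where
  "vshift m c (VTm t) = VTm (shift m c t)"
| "vshift m c VUnit = VUnit"
| "vshift m c (VPair v w) = VPair (vshift m c v) (vshift m c w)"
| "vshift m c (VClo p v) = VClo p (vshift m c v)"
| "vshift m c (VNe A B t) = VNe A B (shift m c t)"
| "vshift m c (VLock k v) =
     (if c \<le> k then VLock (k + m) v else VLock k (vshift m (c - Suc k) v))"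
| "vshift m c (VBox v) = VBox (vshift m (Suc c) v)"

lemma vshift_0 [simp]: "vshift 0 c v = v"
  by (induction v arbitrary: c) auto

lemma vshift_fuse: "d \<le> c \<Longrightarrow> c \<le> d + k \<Longrightarrow> vshift m c (vshift k d v) = vshift (k + m) d v"
proof (induction v arbitrary: c d)
  case (VLock j v)
  show ?case
  proof (cases "d \<le> j")
    case True
    then show ?thesis using VLock.prems by simp
  next
    case False
    then have "d - Suc j \<le> c - Suc j" "c - Suc j \<le> d - Suc j + k" using VLock.prems by auto
    from VLock.IH[OF this] show ?thesis using VLock.prems False by simp
  qed
qed (simp_all add: shift_fuse)

lemma vshift_commute: "d \<le> c \<Longrightarrow> vshift m (c + k) (vshift k d v) = vshift k d (vshift m c v)"
proof (induction v arbitrary: c d)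
  case (VBox v)
  from VBox.IH[of "Suc d" "Suc c"] VBox.prems show ?case by simp
next
  case (VLock j v)
  consider "c \<le> j" | "d \<le> j" "j < c" | "j < d" by linarith
  then show ?case
  proof cases
    case 3
    then obtain d' c' where "d = Suc (j + d')" "c = Suc (j + c')"
      using VLock.prems by (metis less_iff_Suc_add order_less_le_trans)
    with VLock.IH[of d' c'] VLock.prems show ?thesis by simp
  qed (use VLock.prems in auto)
qed (simp_all add: shift_commute)

lemma vshift_commute_1: "vshift m (Suc c) (vshift (Suc 0) 0 v) = vshift (Suc 0) 0 (vshift m c v)"
  using vshift_commute[of 0 c m "Suc 0" v] by simp

text \<open>Boxes are eta-expanded at once, whereas a term of function type stays syntactic; its two
  types are kept for quoting an argument and reflecting the result.\<close>

fun reflect :: "ty \<Rightarrow> tm \<Rightarrow> val" where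
  "reflect Iota t = VTm t"
| "reflect (Arr A B) t = VNe A B t"
| "reflect (Box A) t = VBox (reflect A (Unbox t 0))"

lemma vshift_reflect [simp]: "vshift m c (reflect A t) = reflect A (shift m c t)"
  by (induction A arbitrary: c t) auto

text \<open>A relation, because untyped combinators may get stuck or diverge; results are shown to
  exist only on values in the domain of \<open>rel\<close>. The shift in \<open>eval_PCounit\<close>
  is the weakening of \<open>wk_lockext\<close>, and \<open>Var 0\<close> in
  \<open>quote_Arr\<close> is a fresh variable.\<close>

inductive eval :: "prog \<Rightarrow> val \<Rightarrow> val \<Rightarrow> bool"
  and apply_val :: "val \<Rightarrow> val \<Rightarrow> val \<Rightarrow> bool"
  and quote :: "ty \<Rightarrow> val \<Rightarrow> tm \<Rightarrow> bool" where
  eval_PId: "eval PId v v"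
| eval_PComp: "eval p v w \<Longrightarrow> eval q w r \<Longrightarrow> eval (PComp q p) v r"
| eval_PBang: "eval PBang v VUnit"
| eval_PFst: "eval PFst (VPair v w) v"
| eval_PSnd: "eval PSnd (VPair v w) w"
| eval_PPair: "eval p v r \<Longrightarrow> eval q v s \<Longrightarrow> eval (PPair p q) v (VPair r s)"
| eval_PEv: "apply_val h v r \<Longrightarrow> eval PEv (VPair h v) r"
| eval_PCurry: "eval (PCurry p) v (VClo p v)"
| eval_PLock: "eval p v r \<Longrightarrow> eval (PLock p) (VLock k v) (VLock k r)"
| eval_PBox: "eval p v r \<Longrightarrow> eval (PBox p) (VBox v) (VBox r)"
| eval_PUnit: "eval PUnit v (VBox (VLock 0 v))"
| eval_PCounit: "eval PCounit (VLock k (VBox v)) (vshift k 0 v)"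
| apply_VClo: "eval p (VPair v w) r \<Longrightarrow> apply_val (VClo p v) w r"
| apply_VNe: "quote A v s \<Longrightarrow> apply_val (VNe A B t) v (reflect B (App t s))"
| quote_Iota: "quote Iota (VTm t) t"
| quote_Arr: "apply_val (vshift (Suc 0) 0 v) (reflect A (Var 0)) r \<Longrightarrow> quote B r s \<Longrightarrow>
    quote (Arr A B) v (Lam A s)"
| quote_Box: "quote A v s \<Longrightarrow> quote (Box A) (VBox v) (BoxI s)"

inductive_cases eval_PIdE [elim!]: "eval PId v r"
inductive_cases eval_PCompE [elim!]: "eval (PComp q p) v r"
inductive_cases eval_PBangE [elim!]: "eval PBang v r"
inductive_cases eval_PFstE [elim!]: "eval PFst v r"
inductive_cases eval_PSndE [elim!]: "eval PSnd v r"
inductive_cases eval_PPairE [elim!]: "eval (PPair p q) v r"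
inductive_cases eval_PEvE [elim!]: "eval PEv v r"
inductive_cases eval_PCurryE [elim!]: "eval (PCurry p) v r"
inductive_cases eval_PLockE [elim!]: "eval (PLock p) v r"
inductive_cases eval_PBoxE [elim!]: "eval (PBox p) v r"
inductive_cases eval_PUnitE [elim!]: "eval PUnit v r"
inductive_cases eval_PCounitE [elim!]: "eval PCounit v r"
inductive_cases apply_VCloE [elim!]: "apply_val (VClo p v) w r"
inductive_cases apply_VNeE [elim!]: "apply_val (VNe A B t) w r"
inductive_cases quote_IotaE [elim!]: "quote Iota v s"
inductive_cases quote_ArrE [elim!]: "quote (Arr A B) v s"
inductive_cases quote_BoxE [elim!]: "quote (Box A) v s"

lemma eval_deterministic:
  "eval p v r \<Longrightarrow> eval p v r' \<Longrightarrow> r = r'"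
  "apply_val h v r \<Longrightarrow> apply_val h v r' \<Longrightarrow> r = r'"
  "quote A v s \<Longrightarrow> quote A v s' \<Longrightarrow> s = s'"
proof (induction arbitrary: r' and r' and s' rule: eval_apply_val_quote.inducts)
qed blast+

text \<open>Combinators are closed, so all dependence on the context sits in the values. This is the
  naturality of the maps that combinators denote.\<close>

lemma eval_vshift:
  "eval p v r \<Longrightarrow> eval p (vshift m c v) (vshift m c r)"
  "apply_val h v r \<Longrightarrow> apply_val (vshift m c h) (vshift m c v) (vshift m c r)"
  "quote A v s \<Longrightarrow> quote A (vshift m c v) (shift m c s)"
proof (induction arbitrary: c and c and c rule: eval_apply_val_quote.inducts)
  case (eval_PCounit k v)
  show ?case
  proof (cases "c \<le> k")
    case True
    then show ?thesis
      using eval_apply_val_quote.eval_PCounit[of "k + m" v] by (simp add: vshift_fuse)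
  next
    case False
    \<comment> \<open>Here the insertion lies beyond the lock. Under \<open>VBox\<close> it takes
      place at \<open>Suc (c - Suc k)\<close>, with one \<open>Suc\<close> for the lock that the box
      adds.\<close>
    then have "vshift m c (vshift k 0 v) = vshift k 0 (vshift m (Suc (c - Suc k)) v)"
      using vshift_commute[of 0 "c - k" m k v] by (simp add: Suc_diff_Suc)
    with False show ?thesis
      using eval_apply_val_quote.eval_PCounit[of k "vshift m (Suc (c - Suc k)) v"] by simp
  qed
next
  case (quote_Arr v A r B s)
  from quote_Arr.IH(1)[of "Suc c"] quote_Arr.IH(2)[of "Suc c"] show ?case
    by (auto simp: vshift_commute_1 intro: eval_apply_val_quote.intros)
qed (auto intro: eval_apply_val_quote.intros)

section \<open>Kripke worlds\<close>

text \<open>Worlds are compared by lists of insertions because two insertions at unrelated positions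
  do not compose to a single \<open>wk\<close>.\<close>

fun wks :: "(nat \<times> nat) list \<Rightarrow> ctx \<Rightarrow> ctx \<Rightarrow> bool" where
  "wks [] G D \<longleftrightarrow> G = D"
| "wks (mc # w) G D \<longleftrightarrow> (\<exists>G'. wk (fst mc) (snd mc) G G' \<and> wks w G' D)"

fun shifts :: "(nat \<times> nat) list \<Rightarrow> tm \<Rightarrow> tm" where
  "shifts [] t = t"
| "shifts (mc # w) t = shifts w (shift (fst mc) (snd mc) t)"

fun vshifts :: "(nat \<times> nat) list \<Rightarrow> val \<Rightarrow> val" where
  "vshifts [] v = v"
| "vshifts (mc # w) v = vshifts w (vshift (fst mc) (snd mc) v)"

lemma eval_vshifts: "eval p v r \<Longrightarrow> eval p (vshifts w v) (vshifts w r)"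
  by (induction w arbitrary: v r) (auto intro: eval_vshift)

lemma typed_wks: "typed G t A \<Longrightarrow> wks w G D \<Longrightarrow> typed D (shifts w t) A"
  by (induction w arbitrary: G t) (auto intro: typed_wk)

lemma eqv_wks: "eqv G t u A \<Longrightarrow> wks w G D \<Longrightarrow> eqv D (shifts w t) (shifts w u) A"
  by (induction w arbitrary: G t u) (auto intro: eqv_wk)

lemma vshifts_VClo [simp]: "vshifts w (VClo p v) = VClo p (vshifts w v)"
  by (induction w arbitrary: v) auto

lemma vshifts_VNe [simp]: "vshifts w (VNe A B t) = VNe A B (shifts w t)"
  by (induction w arbitrary: t) auto

text \<open>A Kripke family of partial equivalence relations; the elements of an object at
  \<open>G\<close> are the values related to themselves. The clause for \<open>OExp\<close> makes
  functions extensional and demands that applications have results in every later world.\<close>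

primrec rel :: "ob \<Rightarrow> ctx \<Rightarrow> val \<Rightarrow> val \<Rightarrow> bool" where
  "rel OBase G v v' \<longleftrightarrow> (\<exists>t t'. v = VTm t \<and> v' = VTm t' \<and> eqv G t t' Iota)"
| "rel OUnit G v v' \<longleftrightarrow> v = VUnit \<and> v' = VUnit"
| "rel (OProd X Y) G v v' \<longleftrightarrow>
    (\<exists>a a' b b'. v = VPair a b \<and> v' = VPair a' b' \<and> rel X G a a' \<and> rel Y G b b')"
| "rel (OExp X Y) G v v' \<longleftrightarrow>
    (\<forall>w D a a'. wks w G D \<longrightarrow> rel X D a a' \<longrightarrow>
      (\<exists>r r'. apply_val (vshifts w v) a r \<and> apply_val (vshifts w v') a' r' \<and> rel Y D r r'))"
| "rel (OLock X) G v v' \<longleftrightarrow>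
    (\<exists>k a a'. v = VLock k a \<and> v' = VLock k a' \<and> lockext G k \<and> rel X (drop (Suc k) G) a a')"
| "rel (OBox X) G v v' \<longleftrightarrow> (\<exists>a a'. v = VBox a \<and> v' = VBox a' \<and> rel X (Lock # G) a a')"

lemma rel_sym: "rel X G v v' \<Longrightarrow> rel X G v' v"
proof (induction X arbitrary: G v v')
  case (OExp X Y)
  show ?case
    unfolding rel.simps
  proof (intro allI impI)
    fix w D a a' assume "wks w G D" "rel X D a a'"
    with OExp.prems OExp.IH(1) obtain r r' where
      "apply_val (vshifts w v) a' r" "apply_val (vshifts w v') a r'" "rel Y D r r'" by fastforce
    with OExp.IH(2) show "\<exists>r r'. apply_val (vshifts w v') a r \<and> apply_val (vshifts w v) a' r' \<and> rel Y D r r'"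
      by blast
  qed
qed (auto intro: e_sym)

text \<open>At \<open>OExp\<close>, the first relation is used on \<open>a\<close>,
  \<open>a'\<close> and the second on \<open>a'\<close>, \<open>a'\<close>, which is related by
  symmetry and transitivity at \<open>X\<close>. Determinism identifies the two results of
  \<open>v'\<close> on \<open>a'\<close>.\<close>

lemma rel_trans: "rel X G v v' \<Longrightarrow> rel X G v' v'' \<Longrightarrow> rel X G v v''"
proof (induction X arbitrary: G v v' v'')
  case (OExp X Y)
  show ?case
    unfolding rel.simps
  proof (intro allI impI)
    fix w D a a' assume w: "wks w G D" and a: "rel X D a a'"
    have a': "rel X D a' a'" using a OExp.IH(1) rel_sym by blast
    from OExp.prems(1) w a obtain r r' where r:
      "apply_val (vshifts w v) a r" "apply_val (vshifts w v') a' r'" "rel Y D r r'" by fastforce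
    from OExp.prems(2) w a' obtain s s' where s:
      "apply_val (vshifts w v') a' s" "apply_val (vshifts w v'') a' s'" "rel Y D s s'" by fastforce
    have "r' = s" using r s eval_deterministic(2) by blast
    with r s OExp.IH(2)
    show "\<exists>r r'. apply_val (vshifts w v) a r \<and> apply_val (vshifts w v'') a' r' \<and> rel Y D r r'"
      by blast
  qed
next
  case OBase
  then show ?case by (auto intro: e_trans)
qed (fastforce+)

lemma rel_wk: "rel X G v v' \<Longrightarrow> wk m c G D \<Longrightarrow> rel X D (vshift m c v) (vshift m c v')"
proof (induction X arbitrary: G D v v' c)
  case OBase
  then show ?case by (auto intro: eqv_wk)
next
  case (OExp X Y)
  show ?case
    unfolding rel.simps
  proof (intro allI impI)
    fix w D' a a' assume "wks w D D'" and a: "rel X D' a a'"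
    \<comment> \<open>A world later than \<open>D\<close> is later than \<open>G\<close> once the
      new insertion is put in front.\<close>
    then have "wks ((m, c) # w) G D'" using OExp.prems by auto
    with OExp.prems(1) a show "\<exists>r r'. apply_val (vshifts w (vshift m c v)) a r \<and>
        apply_val (vshifts w (vshift m c v')) a' r' \<and> rel Y D' r r'"
      unfolding rel.simps by (metis vshifts.simps(2) fst_conv snd_conv)
  qed
next
  case (OLock X)
  then obtain k a a' where k: "v = VLock k a" "v' = VLock k a'" "lockext G k"
    "rel X (drop (Suc k) G) a a'" by auto
  show ?case
  proof (cases "c \<le> k")
    case True
    with lockext_wk_le[OF OLock.prems(2) k(3)] k show ?thesis by auto
  next
    case False
    with lockext_wk_gt[OF OLock.prems(2) k(3)] k OLock.IH show ?thesis by auto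
  qed
next
  case (OBox X)
  then show ?case by (auto intro: OBox.IH[OF _ wk_Suc])
qed auto

lemma rel_wks: "rel X G v v' \<Longrightarrow> wks w G D \<Longrightarrow> rel X D (vshifts w v) (vshifts w v')"
  by (induction w arbitrary: G v v') (auto intro: rel_wk)

fun oty :: "ty \<Rightarrow> ob" where
  "oty Iota = OBase"
| "oty (Arr A B) = OExp (oty A) (oty B)"
| "oty (Box A) = OBox (oty A)"

fun octx :: "ctx \<Rightarrow> ob" where
  "octx [] = OUnit"
| "octx (CTy A # G) = OProd (octx G) (oty A)"
| "octx (Lock # G) = OLock (octx G)"

text \<open>The two claims need each other at function types: reifying a function applies it to a
  reflected fresh variable, and applying a reflected term reifies the argument.\<close>

lemma rel_reify_reflect:
  "rel (oty A) G v v' \<Longrightarrow> \<exists>s s'. quote A v s \<and> quote A v' s' \<and> eqv G s s' A"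
  "eqv G t t' A \<Longrightarrow> rel (oty A) G (reflect A t) (reflect A t')"
proof (induction A arbitrary: G v v' t t')
  case Iota
  {
    case 1
    then show ?case by (auto intro: quote_Iota)
  next
    case 2
    then show ?case by auto
  }
next
  case (Arr A B)
  {
    case 1
    have "rel (oty A) (CTy A # G) (reflect A (Var 0)) (reflect A (Var 0))"
      by (intro Arr.IH e_refl t_var) simp
    moreover have "wks [(Suc 0, 0)] G (CTy A # G)" by (simp add: wk_CTy)
    ultimately obtain r r' where r: "apply_val (vshifts [(Suc 0, 0)] v) (reflect A (Var 0)) r"
      "apply_val (vshifts [(Suc 0, 0)] v') (reflect A (Var 0)) r'" "rel (oty B) (CTy A # G) r r'"
      using 1 by (metis oty.simps(2) rel.simps(4))
    from Arr.IH(3)[OF r(3)] obtain s s' where "quote B r s" "quote B r' s'" "eqv (CTy A # G) s s' B"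
      by blast
    with r show ?case by (fastforce intro: quote_Arr e_lam)
  next
    case 2
    show ?case
      unfolding oty.simps rel.simps
    proof (intro allI impI)
      fix w D a a' assume w: "wks w G D" and a: "rel (oty A) D a a'"
      from Arr.IH(1)[OF a] obtain s s' where s: "quote A a s" "quote A a' s'" "eqv D s s' A" by blast
      have "eqv D (App (shifts w t) s) (App (shifts w t') s') B"
        using eqv_wks[OF 2 w] s by (blast intro: e_app)
      from Arr.IH(4)[OF this] s
      show "\<exists>r r'. apply_val (vshifts w (reflect (Arr A B) t)) a r \<and>
          apply_val (vshifts w (reflect (Arr A B) t')) a' r' \<and> rel (oty B) D r r'"
        by (auto intro: apply_VNe)
    qed
  }
next
  case (Box A)
  {
    case 1
    then show ?case by (fastforce dest: Box.IH(1) intro: quote_Box e_box)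
  next
    case 2
    then have "eqv (Lock # G) (Unbox t 0) (Unbox t' 0) A" by (intro e_unbox) auto
    from Box.IH(2)[OF this] show ?case by simp
  }
qed

text \<open>The generic environment, made of reflected variables, at which values are read
  back.\<close>

fun idval :: "ctx \<Rightarrow> val" where
  "idval [] = VUnit"
| "idval (CTy A # G) = VPair (vshift (Suc 0) 0 (idval G)) (reflect A (Var 0))"
| "idval (Lock # G) = VLock 0 (idval G)"

lemma rel_idval: "rel (octx G) G (idval G) (idval G)"
  by (induction G rule: octx.induct)
    (auto intro!: rel_wk[OF _ wk_CTy] rel_reify_reflect(2) e_refl t_var)

section \<open>A countable model\<close>

text \<open>Extensional equality of combinators, again a partial equivalence:
  \<open>eqp X Y p p\<close> says that \<open>p\<close> denotes an arrow from \<open>X\<close> to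
  \<open>Y\<close>.\<close>

definition eqp :: "ob \<Rightarrow> ob \<Rightarrow> prog \<Rightarrow> prog \<Rightarrow> bool" where
  "eqp X Y p q \<longleftrightarrow>
    (\<forall>G v v'. rel X G v v' \<longrightarrow> (\<exists>r r'. eval p v r \<and> eval q v' r' \<and> rel Y G r r'))"

lemma eqpD: "eqp X Y p q \<Longrightarrow> rel X G v v' \<Longrightarrow> \<exists>r r'. eval p v r \<and> eval q v' r' \<and> rel Y G r r'"
  by (auto simp: eqp_def)

lemma eqp_sym: "eqp X Y p q \<Longrightarrow> eqp X Y q p"
  unfolding eqp_def by (meson rel_sym)

lemma eqp_trans:
  assumes "eqp X Y p q" "eqp X Y q s"
  shows "eqp X Y p s"
  unfolding eqp_def
proof (intro allI impI)
  fix G v v' assume v: "rel X G v v'"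
  then have v': "rel X G v' v'" using rel_sym rel_trans by blast
  from eqpD[OF assms(1) v] eqpD[OF assms(2) v']
  show "\<exists>r r'. eval p v r \<and> eval s v' r' \<and> rel Y G r r'"
    using eval_deterministic(1) rel_trans by metis
qed

lemma eqp_PId: "eqp X X PId PId"
  by (auto simp: eqp_def intro: eval_PId)

lemma eqp_PComp: "eqp X Y p p' \<Longrightarrow> eqp Y Z q q' \<Longrightarrow> eqp X Z (PComp q p) (PComp q' p')"
  unfolding eqp_def by (meson eval_PComp)

lemma eqp_PBang: "eqp X OUnit PBang PBang"
  by (auto simp: eqp_def intro: eval_PBang)

lemma eqp_PFst: "eqp (OProd X Y) X PFst PFst"
  by (auto simp: eqp_def intro: eval_PFst)

lemma eqp_PSnd: "eqp (OProd X Y) Y PSnd PSnd"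
  by (auto simp: eqp_def intro: eval_PSnd)

lemma eqp_PPair:
  "eqp X Y p p' \<Longrightarrow> eqp X Z q q' \<Longrightarrow> eqp X (OProd Y Z) (PPair p q) (PPair p' q')"
  by (subst eqp_def) (fastforce dest: eqpD intro: eval_PPair)

lemma eqp_PEv: "eqp (OProd (OExp X Y) X) Y PEv PEv"
proof -
  have "\<exists>r r'. eval PEv v r \<and> eval PEv v' r' \<and> rel Y G r r'"
    if "rel (OProd (OExp X Y) X) G v v'" for G v v'
  proof -
    from that obtain h h' a a' where h: "v = VPair h a" "v' = VPair h' a'"
      "rel (OExp X Y) G h h'" "rel X G a a'" by auto
    \<comment> \<open>The empty list of insertions instantiates the Kripke quantifier at the present
      world.\<close>
    then obtain r r' where "apply_val (vshifts [] h) a r" "apply_val (vshifts [] h') a' r'" "rel Y G r r'"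
      unfolding rel.simps by (metis wks.simps(1))
    with h show ?thesis by (auto intro: eval_PEv)
  qed
  then show ?thesis by (auto simp: eqp_def)
qed

lemma eqp_PCurry:
  assumes "eqp (OProd Z X) Y p p'"
  shows "eqp Z (OExp X Y) (PCurry p) (PCurry p')"
proof -
  have "rel (OExp X Y) G (VClo p v) (VClo p' v')" if v: "rel Z G v v'" for G v v'
    unfolding rel.simps
  proof (intro allI impI)
    fix w D a a' assume "wks w G D" "rel X D a a'"
    with rel_wks[OF v] have "rel (OProd Z X) D (VPair (vshifts w v) a) (VPair (vshifts w v') a')"
      by auto
    from eqpD[OF assms this]
    show "\<exists>r r'. apply_val (vshifts w (VClo p v)) a r \<and>
        apply_val (vshifts w (VClo p' v')) a' r' \<and> rel Y D r r'"
      by (auto intro: apply_VClo)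
  qed
  then show ?thesis unfolding eqp_def by (blast intro: eval_PCurry)
qed

lemma eqp_PLock: "eqp X Y p p' \<Longrightarrow> eqp (OLock X) (OLock Y) (PLock p) (PLock p')"
  by (subst eqp_def) (fastforce dest: eqpD intro: eval_PLock)

lemma eqp_PBox: "eqp X Y p p' \<Longrightarrow> eqp (OBox X) (OBox Y) (PBox p) (PBox p')"
  by (subst eqp_def) (fastforce dest: eqpD intro: eval_PBox)

lemma eqp_PUnit: "eqp X (OBox (OLock X)) PUnit PUnit"
proof -
  have "rel (OBox (OLock X)) G (VBox (VLock 0 v)) (VBox (VLock 0 v'))" if "rel X G v v'" for G v v'
    using that by simp
  then show ?thesis unfolding eqp_def by (blast intro: eval_PUnit)
qed

lemma eqp_PCounit: "eqp (OLock (OBox X)) X PCounit PCounit"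
  unfolding eqp_def
proof (intro allI impI)
  fix G v v' assume "rel (OLock (OBox X)) G v v'"
  then obtain k a a' where k: "v = VLock k (VBox a)" "v' = VLock k (VBox a')" "lockext G k"
    "rel X (Lock # drop (Suc k) G) a a'" by auto
  \<comment> \<open>The content of the box lives over \<open>Lock # drop (Suc k) G\<close>; the
    factored weakening brings it to \<open>G\<close>.\<close>
  from rel_wk[OF k(4) wk_lockext[OF k(3)]] k
  show "\<exists>r r'. eval PCounit v r \<and> eval PCounit v' r' \<and> rel X G r r'"
    by (blast intro: eval_PCounit)
qed

lemmas eqp_intros = eqp_PId eqp_PComp eqp_PBang eqp_PFst eqp_PSnd eqp_PPair eqp_PEv eqp_PCurry
  eqp_PLock eqp_PBox eqp_PUnit eqp_PCounit

text \<open>Self-relatedness of \<open>p\<close> supplies the results, so \<open>q\<close> need only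
  reproduce the run of \<open>p\<close> on the second of two related values. Most laws below thus
  reduce to inverting evaluation.\<close>

lemma eqp_pointwise:
  assumes "eqp X Y p p" "\<And>G v v' r. rel X G v' v \<Longrightarrow> eval p v r \<Longrightarrow> eval q v r"
  shows "eqp X Y p q"
  using assms unfolding eqp_def by meson

text \<open>A quotient by chosen representatives, so that arrows are equal as numbers. The objects
  are stored as well, since operations such as \<open>c_comp\<close> receive only arrows.\<close>

definition arrow :: "ob \<Rightarrow> ob \<Rightarrow> prog \<Rightarrow> nat" where
  "arrow X Y p = to_nat (X, Y, SOME q. eqp X Y p q)"

definition adom :: "nat \<Rightarrow> ob" where "adom f = fst (from_nat f :: ob \<times> ob \<times> prog)"
definition acod :: "nat \<Rightarrow> ob" where "acod f = fst (snd (from_nat f :: ob \<times> ob \<times> prog))"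
definition aprog :: "nat \<Rightarrow> prog" where "aprog f = snd (snd (from_nat f :: ob \<times> ob \<times> prog))"

lemma adom_arrow [simp]: "adom (arrow X Y p) = X"
  and acod_arrow [simp]: "acod (arrow X Y p) = Y"
  by (simp_all add: adom_def acod_def arrow_def)

lemma eqp_aprog: "eqp X Y p p \<Longrightarrow> eqp X Y (aprog (arrow X Y p)) p"
  by (auto simp: aprog_def arrow_def intro: someI eqp_sym)

text \<open>Equivalent combinators give the same predicate \<open>eqp X Y p\<close>, and hence the
  same choice under \<open>SOME\<close>.\<close>

lemma arrow_eq: "eqp X Y p q \<Longrightarrow> arrow X Y p = arrow X Y q"
proof -
  assume "eqp X Y p q"
  then have "eqp X Y p = eqp X Y q" using eqp_sym eqp_trans by blast
  then show ?thesis by (simp add: arrow_def)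
qed

lemma arrow_eqD:
  assumes "arrow X Y p = arrow X Y q" "eqp X Y p p" "eqp X Y q q"
  shows "eqp X Y p q"
  using eqp_aprog[OF assms(2)] eqp_aprog[OF assms(3)] assms(1) eqp_sym eqp_trans by metis

text \<open>Coded by natural numbers because the models in the theorem have \<open>nat\<close> as
  carriers.\<close>

definition term_model :: "(nat, nat) cccadj" where
  "term_model = \<lparr>
    c_ob = range (to_nat :: ob \<Rightarrow> nat),
    c_hom = \<lambda>X Y. {arrow (from_nat X) (from_nat Y) p |p. eqp (from_nat X) (from_nat Y) p p},
    c_comp = \<lambda>g f. arrow (adom f) (acod g) (PComp (aprog g) (aprog f)),
    c_id = \<lambda>X. arrow (from_nat X) (from_nat X) PId,
    c_term = to_nat OUnit,
    c_bang = \<lambda>X. arrow (from_nat X) OUnit PBang,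
    c_prod = \<lambda>X Y. to_nat (OProd (from_nat X) (from_nat Y)),
    c_pi1 = \<lambda>X Y. arrow (OProd (from_nat X) (from_nat Y)) (from_nat X) PFst,
    c_pi2 = \<lambda>X Y. arrow (OProd (from_nat X) (from_nat Y)) (from_nat Y) PSnd,
    c_pair = \<lambda>f g. arrow (adom f) (OProd (acod f) (acod g)) (PPair (aprog f) (aprog g)),
    c_exp = \<lambda>X Y. to_nat (OExp (from_nat X) (from_nat Y)),
    c_ev = \<lambda>X Y. arrow (OProd (OExp (from_nat X) (from_nat Y)) (from_nat X)) (from_nat Y) PEv,
    c_curry = \<lambda>Z X Y f. arrow (from_nat Z) (OExp (from_nat X) (from_nat Y)) (PCurry (aprog f)),
    c_lko = \<lambda>X. to_nat (OLock (from_nat X)),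
    c_lka = \<lambda>f. arrow (OLock (adom f)) (OLock (acod f)) (PLock (aprog f)),
    c_bxo = \<lambda>X. to_nat (OBox (from_nat X)),
    c_bxa = \<lambda>f. arrow (OBox (adom f)) (OBox (acod f)) (PBox (aprog f)),
    c_unit = \<lambda>X. arrow (from_nat X) (OBox (OLock (from_nat X))) PUnit,
    c_counit = \<lambda>X. arrow (OLock (OBox (from_nat X))) (from_nat X) PCounit\<rparr>"

lemma term_model_simps [simp]:
  "c_ob term_model = range (to_nat :: ob \<Rightarrow> nat)"
  "c_id term_model (to_nat X) = arrow X X PId"
  "c_term term_model = to_nat OUnit"
  "c_bang term_model (to_nat X) = arrow X OUnit PBang"
  "c_prod term_model (to_nat X) (to_nat Y) = to_nat (OProd X Y)"
  "c_pi1 term_model (to_nat X) (to_nat Y) = arrow (OProd X Y) X PFst"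
  "c_pi2 term_model (to_nat X) (to_nat Y) = arrow (OProd X Y) Y PSnd"
  "c_exp term_model (to_nat X) (to_nat Y) = to_nat (OExp X Y)"
  "c_ev term_model (to_nat X) (to_nat Y) = arrow (OProd (OExp X Y) X) Y PEv"
  "c_lko term_model (to_nat X) = to_nat (OLock X)"
  "c_bxo term_model (to_nat X) = to_nat (OBox X)"
  "c_unit term_model (to_nat X) = arrow X (OBox (OLock X)) PUnit"
  "c_counit term_model (to_nat X) = arrow (OLock (OBox X)) X PCounit"
  by (simp_all add: term_model_def)

lemma arrow_in_hom: "eqp X Y p p \<Longrightarrow> arrow X Y p \<in> c_hom term_model (to_nat X) (to_nat Y)"
  and ball_hom: "(\<forall>f \<in> c_hom term_model (to_nat X) (to_nat Y). Q f) \<longleftrightarrow>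
    (\<forall>p. eqp X Y p p \<longrightarrow> Q (arrow X Y p))"
  by (auto simp: term_model_def)

lemma c_comp_arrow [simp]:
  "eqp X Y p p \<Longrightarrow> eqp Y Z q q \<Longrightarrow>
    c_comp term_model (arrow Y Z q) (arrow X Y p) = arrow X Z (PComp q p)"
  by (auto simp: term_model_def intro!: arrow_eq intro: eqp_PComp eqp_aprog)

lemma c_pair_arrow [simp]:
  "eqp X Y p p \<Longrightarrow> eqp X Z q q \<Longrightarrow>
    c_pair term_model (arrow X Y p) (arrow X Z q) = arrow X (OProd Y Z) (PPair p q)"
  by (auto simp: term_model_def intro!: arrow_eq eqp_PPair eqp_aprog)

lemma c_curry_arrow [simp]:
  "eqp (OProd Z X) Y p p \<Longrightarrow>
    c_curry term_model (to_nat Z) (to_nat X) (to_nat Y) (arrow (OProd Z X) Y p) =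
      arrow Z (OExp X Y) (PCurry p)"
  by (auto simp: term_model_def intro!: arrow_eq eqp_PCurry eqp_aprog)

lemma c_lka_arrow [simp]:
  "eqp X Y p p \<Longrightarrow> c_lka term_model (arrow X Y p) = arrow (OLock X) (OLock Y) (PLock p)"
  by (auto simp: term_model_def intro!: arrow_eq eqp_PLock eqp_aprog)

lemma c_bxa_arrow [simp]:
  "eqp X Y p p \<Longrightarrow> c_bxa term_model (arrow X Y p) = arrow (OBox X) (OBox Y) (PBox p)"
  by (auto simp: term_model_def intro!: arrow_eq eqp_PBox eqp_aprog)

section \<open>Equational laws of the model, stated for combinators\<close>

lemma eqp_PId_left: "eqp X Y p p \<Longrightarrow> eqp X Y (PComp PId p) p"
  and eqp_PId_right: "eqp X Y p p \<Longrightarrow> eqp X Y (PComp p PId) p"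
  by (rule eqp_pointwise, (rule eqp_intros | assumption)+, blast)+

lemma eqp_PComp_assoc:
  "eqp W X p p \<Longrightarrow> eqp X Y q q \<Longrightarrow> eqp Y Z s s \<Longrightarrow>
    eqp W Z (PComp s (PComp q p)) (PComp (PComp s q) p)"
  by (rule eqp_pointwise, (rule eqp_intros | assumption)+) (blast intro: eval_PComp)

lemma eqp_PBang_unique: "eqp X OUnit p p \<Longrightarrow> eqp X OUnit p PBang"
  unfolding eqp_def by (auto intro: eval_PBang)

lemma eqp_PFst_PPair: "eqp Z X p p \<Longrightarrow> eqp Z Y q q \<Longrightarrow> eqp Z X (PComp PFst (PPair p q)) p"
  and eqp_PSnd_PPair: "eqp Z X p p \<Longrightarrow> eqp Z Y q q \<Longrightarrow> eqp Z Y (PComp PSnd (PPair p q)) q"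
  by (rule eqp_pointwise, (rule eqp_intros | assumption)+, blast)+

lemma eqp_PPair_eta:
  assumes "eqp Z (OProd X Y) p p"
  shows "eqp Z (OProd X Y) (PPair (PComp PFst p) (PComp PSnd p)) p"
proof (rule eqp_pointwise)
  show "eqp Z (OProd X Y) (PPair (PComp PFst p) (PComp PSnd p)) (PPair (PComp PFst p) (PComp PSnd p))"
    using assms by (intro eqp_PPair eqp_PComp[OF _ eqp_PFst] eqp_PComp[OF _ eqp_PSnd])
\<comment> \<open>The left side runs \<open>p\<close> twice; determinism makes both runs yield the
  same pair.\<close>
qed (auto dest: eval_deterministic(1))

lemma eqp_beta:
  assumes "eqp (OProd Z X) Y p p"
  shows "eqp (OProd Z X) Y (PComp PEv (PPair (PComp (PCurry p) PFst) PSnd)) p"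
proof (rule eqp_pointwise)
  show "eqp (OProd Z X) Y (PComp PEv (PPair (PComp (PCurry p) PFst) PSnd))
      (PComp PEv (PPair (PComp (PCurry p) PFst) PSnd))"
    by (rule eqp_intros assms)+
qed auto

text \<open>Here \<open>eqp_pointwise\<close> does not apply: the closure and the value of
  \<open>p\<close> are different values, equal only through their applications in later
  worlds.\<close>

lemma eqp_eta:
  assumes p: "eqp Z (OExp X Y) p p"
  shows "eqp Z (OExp X Y) (PCurry (PComp PEv (PPair (PComp p PFst) PSnd))) p"
  unfolding eqp_def
proof (intro allI impI)
  fix G v v' assume v: "rel Z G v v'"
  from eqpD[OF p v] obtain r r' where r: "eval p v r" "eval p v' r'" "rel (OExp X Y) G r r'" by blast
  let ?q = "PComp PEv (PPair (PComp p PFst) PSnd)"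
  have "rel (OExp X Y) G (VClo ?q v) r'"
    unfolding rel.simps
  proof (intro allI impI)
    fix w D a a' assume "wks w G D" "rel X D a a'"
    with r(3) obtain s s' where s: "apply_val (vshifts w r) a s"
      "apply_val (vshifts w r') a' s'" "rel Y D s s'" unfolding rel.simps by blast
    \<comment> \<open>The run of \<open>p\<close> on \<open>v\<close> is transported to the later
      world by \<open>eval_vshifts\<close>.\<close>
    have "apply_val (vshifts w (VClo ?q v)) a s"
      unfolding vshifts_VClo
      by (rule eval_apply_val_quote.intros eval_vshifts r s)+
    with s show "\<exists>s s'. apply_val (vshifts w (VClo ?q v)) a s \<and> apply_val (vshifts w r') a' s' \<and> rel Y D s s'"
      by blast
  qed
  with r show "\<exists>r r'. eval (PCurry ?q) v r \<and> eval p v' r' \<and> rel (OExp X Y) G r r'"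
    by (blast intro: eval_PCurry)
qed

lemma eqp_PLock_PId: "eqp (OLock X) (OLock X) (PLock PId) PId"
  and eqp_PBox_PId: "eqp (OBox X) (OBox X) (PBox PId) PId"
  by (rule eqp_pointwise, (rule eqp_intros)+, auto intro: eval_PId)+

lemma eqp_PLock_PComp: "eqp X Y p p \<Longrightarrow> eqp Y Z q q \<Longrightarrow>
    eqp (OLock X) (OLock Z) (PLock (PComp q p)) (PComp (PLock q) (PLock p))"
  and eqp_PBox_PComp: "eqp X Y p p \<Longrightarrow> eqp Y Z q q \<Longrightarrow>
    eqp (OBox X) (OBox Z) (PBox (PComp q p)) (PComp (PBox q) (PBox p))"
  by (rule eqp_pointwise, (rule eqp_intros | assumption)+,
      auto intro: eval_apply_val_quote.intros)+

lemma eqp_PUnit_natural: "eqp X Y p p \<Longrightarrow>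
    eqp X (OBox (OLock Y)) (PComp PUnit p) (PComp (PBox (PLock p)) PUnit)"
  by (rule eqp_pointwise, (rule eqp_intros | assumption)+)
    (auto intro: eval_apply_val_quote.intros)

text \<open>One side weakens the result of \<open>p\<close>, the other its argument;
  \<open>eval_vshift\<close> reconciles them.\<close>

lemma eqp_PCounit_natural: "eqp X Y p p \<Longrightarrow>
    eqp (OLock (OBox X)) Y (PComp PCounit (PLock (PBox p))) (PComp p PCounit)"
  by (rule eqp_pointwise, (rule eqp_intros | assumption)+)
    (auto intro: eval_apply_val_quote.intros eval_vshift)

text \<open>The unit creates \<open>VLock 0\<close>, which the counit's weakening by
  \<open>k\<close> turns back into \<open>VLock k\<close>.\<close>

lemma eqp_triangle_lock: "eqp (OLock X) (OLock X) (PComp PCounit (PLock PUnit)) PId"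
  by (rule eqp_pointwise, (rule eqp_intros)+) (auto intro: eval_PId)

text \<open>The lock created by the unit is at position 0, so the counit weakens by nothing.\<close>

lemma eqp_triangle_box: "eqp (OBox X) (OBox X) (PComp (PBox PCounit) PUnit) PId"
  by (rule eqp_pointwise, (rule eqp_intros)+) (auto intro: eval_PId)

text \<open>By \<open>ball_hom\<close> the axioms speak of self-related combinators. Computing the
  operations leaves memberships and equations between codes, which \<open>arrow_eq\<close> reduces
  to the laws above.\<close>

lemma is_cccadj_term_model: "is_cccadj term_model"
  unfolding is_cccadj_def Let_def term_model_simps ball_simps ball_hom
proof (intro conjI allI impI, simp_all only: eqp_PId c_lka_arrow c_bxa_arrow eqp_PFst eqp_PSnd
    c_pair_arrow eqp_PEv eqp_PPair c_curry_arrow c_comp_arrow eqp_PUnit eqp_PCounit eqp_PLock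
    eqp_PBox eqp_PCurry eqp_PBang rangeI arrow_in_hom arrow_eq[OF eqp_PId_left]
    arrow_eq[OF eqp_PId_right] arrow_eq[OF eqp_PLock_PId] arrow_eq[OF eqp_PBox_PId])
qed ((rule arrow_in_hom eqp_intros eqp_PComp_assoc[THEN arrow_eq] eqp_PFst_PPair[THEN arrow_eq]
    eqp_PSnd_PPair[THEN arrow_eq] eqp_PPair_eta[THEN arrow_eq] eqp_beta[THEN arrow_eq]
    eqp_eta[THEN arrow_eq] eqp_PLock_PComp[THEN arrow_eq] eqp_PBox_PComp[THEN arrow_eq]
    eqp_PUnit_natural[THEN arrow_eq] eqp_PCounit_natural[THEN arrow_eq]
    eqp_triangle_lock[THEN arrow_eq] eqp_triangle_box[THEN arrow_eq]
    eqp_PBang_unique[THEN arrow_eq] | assumption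
  | subst c_comp_arrow c_pair_arrow c_lka_arrow c_bxa_arrow c_curry_arrow)+)

section \<open>Interpretation of terms in the model\<close>

fun var_prog :: "nat \<Rightarrow> prog" where
  "var_prog 0 = PSnd"
| "var_prog (Suc n) = PComp (var_prog n) PFst"

fun ext_prog :: "nat \<Rightarrow> prog" where
  "ext_prog 0 = PId"
| "ext_prog (Suc k) = PComp (ext_prog k) PFst"

fun tm_prog :: "tm \<Rightarrow> prog" where
  "tm_prog (Var n) = var_prog n"
| "tm_prog (Lam A t) = PCurry (tm_prog t)"
| "tm_prog (App t u) = PComp PEv (PPair (tm_prog t) (tm_prog u))"
| "tm_prog (BoxI t) = PComp (PBox (tm_prog t)) PUnit"
| "tm_prog (Unbox t k) = PComp (PComp PCounit (PLock (tm_prog t))) (ext_prog k)"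

abbreviation base_ob :: nat where "base_ob \<equiv> to_nat OBase"

lemma ity_term_model [simp]: "ity term_model base_ob A = to_nat (oty A)"
  by (induction A) auto

lemma ictx_term_model [simp]: "ictx term_model base_ob G = to_nat (octx G)"
  by (induction G rule: octx.induct) auto

lemma infer_typed: "typed G t A \<Longrightarrow> infer G t = Some A"
  by (induction rule: typed.induct) auto

lemma ivar_term_model:
  "lookup G n = Some A \<Longrightarrow>
    eqp (octx G) (oty A) (var_prog n) (var_prog n) \<and>
    ivar term_model base_ob G n = arrow (octx G) (oty A) (var_prog n)"
  by (induction G n rule: lookup.induct) (auto intro: eqp_PSnd eqp_PComp[OF eqp_PFst] simp: eqp_PFst)

lemma iext_term_model:
  "lockext G k \<Longrightarrow>
    eqp (octx G) (OLock (octx (drop (Suc k) G))) (ext_prog k) (ext_prog k) \<and>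
    iext term_model base_ob G k = arrow (octx G) (OLock (octx (drop (Suc k) G))) (ext_prog k)"
proof (induction k arbitrary: G)
  case 0
  then show ?case by (cases G) (auto intro: eqp_PId simp flip: term_model_simps)
next
  case (Suc k)
  then obtain A H where "G = CTy A # H" "lockext H k"
    by (metis ctxe.exhaust list.exhaust lockext_simps(1,3))
  with Suc.IH[of H] show ?case by (auto intro: eqp_PComp[OF eqp_PFst] simp: eqp_PFst)
qed

text \<open>Self-relatedness is proved along with the equation because operations of the model
  compute only on codes of self-related combinators.\<close>

lemma itm_term_model:
  "typed G t A \<Longrightarrow>
    eqp (octx G) (oty A) (tm_prog t) (tm_prog t) \<and>
    itm term_model base_ob G t = arrow (octx G) (oty A) (tm_prog t)"
proof (induction rule: typed.induct)
  case (t_var G n A)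
  then show ?case by (simp add: ivar_term_model)
next
  case (t_lam A G t B)
  then show ?case by (simp add: infer_typed eqp_PCurry)
next
  case (t_app G t A B u)
  then have "eqp (octx G) (OProd (oty (Arr A B)) (oty A)) (PPair (tm_prog t) (tm_prog u))
      (PPair (tm_prog t) (tm_prog u))"
    by (intro eqp_PPair) auto
  with t_app show ?case by (simp add: infer_typed eqp_PEv eqp_PComp[OF _ eqp_PEv])
next
  case (t_box G t A)
  then have "eqp (OBox (OLock (octx G))) (OBox (oty A)) (PBox (tm_prog t)) (PBox (tm_prog t))"
    by (intro eqp_PBox) auto
  with t_box show ?case by (simp add: eqp_PUnit eqp_PComp[OF eqp_PUnit])
next
  case (t_unbox G k t A)
  let ?D = "octx (drop (Suc k) G)"
  have lk: "eqp (OLock ?D) (OLock (oty (Box A))) (PLock (tm_prog t)) (PLock (tm_prog t))"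
    using t_unbox.IH by (intro eqp_PLock) auto
  then have "eqp (OLock ?D) (oty A) (PComp PCounit (PLock (tm_prog t))) (PComp PCounit (PLock (tm_prog t)))"
    by (intro eqp_PComp[OF _ eqp_PCounit]) simp
  with lk t_unbox iext_term_model[OF t_unbox.hyps(1)] show ?case
    by (auto simp: infer_typed eqp_PCounit intro: eqp_PComp)
qed

section \<open>Parallel substitution\<close>

text \<open>The entry \<open>SLock k\<close> substitutes for a lock of the source context: the entries behind it live
  in the target context below its lock at position \<open>k\<close>.\<close>

datatype sube = STm tm | SLock nat

type_synonym sub = "sube list"

text \<open>Entries behind \<open>SLock k\<close> live below the target's lock, so they move only if
  the insertion lies beyond it, with its position recounted from there.\<close>

fun sshift :: "nat \<Rightarrow> nat \<Rightarrow> sub \<Rightarrow> sub" where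
  "sshift m c [] = []"
| "sshift m c (STm t # s) = STm (shift m c t) # sshift m c s"
| "sshift m c (SLock k # s) =
    (if c \<le> k then SLock (k + m) # s else SLock k # sshift m (c - Suc k) s)"

fun sshifts :: "(nat \<times> nat) list \<Rightarrow> sub \<Rightarrow> sub" where
  "sshifts [] s = s"
| "sshifts (mc # w) s = sshifts w (sshift (fst mc) (snd mc) s)"

fun ssubst :: "nat \<Rightarrow> tm \<Rightarrow> sub \<Rightarrow> sub" where
  "ssubst c u [] = []"
| "ssubst c u (STm t # s) = STm (subst c u t) # ssubst c u s"
| "ssubst c u (SLock k # s) =
    (if c < k then SLock (k - 1) # s else SLock k # ssubst (c - Suc k) u s)"

fun sub_var :: "sub \<Rightarrow> nat \<Rightarrow> tm" where
  "sub_var (STm t # s) 0 = t"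
| "sub_var (x # s) (Suc n) = sub_var s n"
| "sub_var _ _ = undefined"

fun sub_lock :: "sub \<Rightarrow> nat \<Rightarrow> nat" where
  "sub_lock (SLock k # s) 0 = k"
| "sub_lock (x # s) (Suc n) = sub_lock s n"
| "sub_lock _ _ = undefined"

fun psub :: "sub \<Rightarrow> tm \<Rightarrow> tm" where
  "psub s (Var n) = sub_var s n"
| "psub s (Lam A t) = Lam A (psub (STm (Var 0) # sshift (Suc 0) 0 s) t)"
| "psub s (App t u) = App (psub s t) (psub s u)"
| "psub s (BoxI t) = BoxI (psub (SLock 0 # s) t)"
| "psub s (Unbox t k) = Unbox (psub (drop (Suc k) s) t) (sub_lock s k)"

text \<open>A check of shapes, without typing the entries, suffices for the commutation laws of
  \<open>psub\<close>.\<close>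

fun fits :: "ctx \<Rightarrow> sub \<Rightarrow> bool" where
  "fits [] [] \<longleftrightarrow> True"
| "fits (CTy A # G) (STm t # s) \<longleftrightarrow> fits G s"
| "fits (Lock # G) (SLock k # s) \<longleftrightarrow> fits G s"
| "fits _ _ \<longleftrightarrow> False"

lemma fits_CTyE: "fits (CTy A # G) s \<Longrightarrow> (\<And>t s'. s = STm t # s' \<Longrightarrow> fits G s' \<Longrightarrow> P) \<Longrightarrow> P"
  by (cases "(CTy A # G, s)" rule: fits.cases) auto

lemma fits_LockE: "fits (Lock # G) s \<Longrightarrow> (\<And>k s'. s = SLock k # s' \<Longrightarrow> fits G s' \<Longrightarrow> P) \<Longrightarrow> P"
  by (cases "(Lock # G, s)" rule: fits.cases) auto

lemma fits_drop: "fits G s \<Longrightarrow> fits (drop k G) (drop k s)"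
  by (induction G s arbitrary: k rule: fits.induct) (auto simp: drop_Cons split: nat.split)

lemma fits_sshift [simp]: "fits G s \<Longrightarrow> fits G (sshift m c s)"
  by (induction G s arbitrary: c rule: fits.induct) auto

lemma sshift_commute_1: "sshift m (Suc c) (sshift (Suc 0) 0 s) = sshift (Suc 0) 0 (sshift m c s)"
  by (induction m c s rule: sshift.induct) (auto simp: shift_commute_1)

lemma ssubst_sshift_cancel: "ssubst 0 u (sshift (Suc 0) 0 s) = s"
  by (induction "Suc 0" "0 :: nat" s rule: sshift.induct) (auto simp: subst_shift_cancel)

lemma ssubst_sshift: "ssubst (Suc c) u (sshift (Suc 0) 0 s) = sshift (Suc 0) 0 (ssubst c u s)"
  using subst_shift[of 0 _ "Suc 0" u]
  by (induction c u s rule: ssubst.induct) auto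

lemma sub_var_sshift:
  "fits G s \<Longrightarrow> lookup G n = Some A \<Longrightarrow> sub_var (sshift m c s) n = shift m c (sub_var s n)"
proof (induction G n arbitrary: s rule: lookup.induct)
qed (auto elim!: fits_CTyE)

lemma sub_var_ssubst:
  "fits G s \<Longrightarrow> lookup G n = Some A \<Longrightarrow> sub_var (ssubst c u s) n = subst c u (sub_var s n)"
proof (induction G n arbitrary: s rule: lookup.induct)
qed (auto elim!: fits_CTyE)

lemma lockext_SucE:
  "lockext G (Suc k) \<Longrightarrow> (\<And>A H. G = CTy A # H \<Longrightarrow> lockext H k \<Longrightarrow> P) \<Longrightarrow> P"
  by (metis ctxe.exhaust list.exhaust lockext_simps(1,3))

lemma lockext_0E: "lockext G 0 \<Longrightarrow> (\<And>H. G = Lock # H \<Longrightarrow> P) \<Longrightarrow> P"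
  by (cases G) auto

lemma sub_lock_sshift:
  "lockext G k \<Longrightarrow> fits G s \<Longrightarrow>
    (if c \<le> sub_lock s k
     then sub_lock (sshift m c s) k = sub_lock s k + m \<and> drop (Suc k) (sshift m c s) = drop (Suc k) s
     else sub_lock (sshift m c s) k = sub_lock s k \<and>
       drop (Suc k) (sshift m c s) = sshift m (c - Suc (sub_lock s k)) (drop (Suc k) s))"
  by (induction k arbitrary: G s)
    (auto elim!: lockext_0E lockext_SucE fits_LockE fits_CTyE)

lemma sub_lock_ssubst:
  "lockext G k \<Longrightarrow> fits G s \<Longrightarrow>
    (if c < sub_lock s k
     then sub_lock (ssubst c u s) k = sub_lock s k - 1 \<and> drop (Suc k) (ssubst c u s) = drop (Suc k) s
     else sub_lock (ssubst c u s) k = sub_lock s k \<and>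
       drop (Suc k) (ssubst c u s) = ssubst (c - Suc (sub_lock s k)) u (drop (Suc k) s))"
  by (induction k arbitrary: G s)
    (auto elim!: lockext_0E lockext_SucE fits_LockE fits_CTyE)

lemma shift_psub: "typed G t A \<Longrightarrow> fits G s \<Longrightarrow> shift m c (psub s t) = psub (sshift m c s) t"
proof (induction arbitrary: c s rule: typed.induct)
  case (t_var G n A)
  then show ?case by (simp add: sub_var_sshift)
next
  case (t_lam A G t B)
  from t_lam.IH[of "STm (Var 0) # sshift (Suc 0) 0 s" "Suc c"] t_lam.prems show ?case
    by (simp add: sshift_commute_1)
next
  case (t_box G t A)
  from t_box.IH[of "SLock 0 # s" "Suc c"] t_box.prems show ?case by simp
next
  case (t_unbox G k t A)
  from sub_lock_sshift[OF t_unbox.hyps(1) t_unbox.prems, of c m]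
    t_unbox.IH[OF fits_drop[OF t_unbox.prems]]
  show ?case by (auto split: if_splits)
qed auto

lemma subst_psub: "typed G t A \<Longrightarrow> fits G s \<Longrightarrow> subst c u (psub s t) = psub (ssubst c u s) t"
proof (induction arbitrary: c s rule: typed.induct)
  case (t_var G n A)
  then show ?case by (simp add: sub_var_ssubst)
next
  case (t_lam A G t B)
  from t_lam.IH[of "STm (Var 0) # sshift (Suc 0) 0 s" "Suc c"] t_lam.prems show ?case
    by (simp add: ssubst_sshift)
next
  case (t_box G t A)
  from t_box.IH[of "SLock 0 # s" "Suc c"] t_box.prems show ?case by simp
next
  case (t_unbox G k t A)
  from sub_lock_ssubst[OF t_unbox.hyps(1) t_unbox.prems, of c u]
    t_unbox.IH[OF fits_drop[OF t_unbox.prems]]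
  show ?case by (auto split: if_splits)
qed auto

text \<open>Substituting \<open>u\<close> at 0 replaces the lifted variable and cancels the shift of
  the remaining entries. This computes the contractum in the beta step of
  \<open>fundamental\<close>.\<close>

lemma subst_psub_lift:
  assumes "typed (CTy A # G) t B" "fits G s"
  shows "subst 0 u (psub (STm (Var 0) # sshift (Suc 0) 0 s) t) = psub (STm u # s) t"
  using subst_psub[OF assms(1), of "STm (Var 0) # sshift (Suc 0) 0 s" 0 u] assms(2)
  by (simp add: ssubst_sshift_cancel)

lemma fits_sshifts [simp]: "fits G s \<Longrightarrow> fits G (sshifts w s)"
  by (induction w arbitrary: s) auto

lemma shifts_psub: "typed G t A \<Longrightarrow> fits G s \<Longrightarrow> shifts w (psub s t) = psub (sshifts w s) t"
  by (induction w arbitrary: s) (auto simp: shift_psub)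

section \<open>The identity substitution\<close>

fun idsub :: "ctx \<Rightarrow> sub" where
  "idsub [] = []"
| "idsub (CTy A # G) = STm (Var 0) # sshift (Suc 0) 0 (idsub G)"
| "idsub (Lock # G) = SLock 0 # idsub G"

lemma fits_idsub: "fits G (idsub G)"
  by (induction G rule: idsub.induct) auto

lemma sub_var_idsub: "lookup G n = Some A \<Longrightarrow> sub_var (idsub G) n = Var n"
  by (induction G n rule: lookup.induct) (auto simp: sub_var_sshift[OF fits_idsub])

lemma sub_lock_idsub:
  "lockext G k \<Longrightarrow> sub_lock (idsub G) k = k \<and> drop (Suc k) (idsub G) = idsub (drop (Suc k) G)"
proof (induction k arbitrary: G)
  case 0
  then show ?case by (auto elim!: lockext_0E)
next
  case (Suc k)
  then obtain A H where G: "G = CTy A # H" "lockext H k" by (blast elim: lockext_SucE)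
  with sub_lock_sshift[OF G(2) fits_idsub, of 0 "Suc 0"] Suc.IH[OF G(2)] show ?case by auto
qed

lemma psub_idsub: "typed G t A \<Longrightarrow> psub (idsub G) t = t"
  by (induction rule: typed.induct) (auto simp: sub_var_idsub sub_lock_idsub)

section \<open>Terms are equal to the readback of their values\<close>

text \<open>Terms are tested by eliminators: application in later worlds for functions,
  \<open>Unbox\<close> under a fresh lock for boxes. Typing is built in so that the eta laws apply
  to realized terms.\<close>

primrec realizes :: "ty \<Rightarrow> ctx \<Rightarrow> tm \<Rightarrow> val \<Rightarrow> bool" where
  "realizes Iota G t v \<longleftrightarrow> typed G t Iota \<and> (\<exists>s. v = VTm s \<and> eqv G t s Iota)"
| "realizes (Arr A B) G t v \<longleftrightarrow> typed G t (Arr A B) \<and>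
    (\<forall>w D u a. wks w G D \<longrightarrow> realizes A D u a \<longrightarrow>
      (\<exists>r. apply_val (vshifts w v) a r \<and> realizes B D (App (shifts w t) u) r))"
| "realizes (Box A) G t v \<longleftrightarrow> typed G t (Box A) \<and>
    (\<exists>a. v = VBox a \<and> realizes A (Lock # G) (Unbox t 0) a)"

lemma realizes_typed: "realizes A G t v \<Longrightarrow> typed G t A"
  by (cases A) auto

text \<open>Lets \<open>fundamental\<close> pass from a contractum to the redex that
  \<open>realizes\<close> tests.\<close>

lemma realizes_eqv:
  "realizes A G t v \<Longrightarrow> eqv G t t' A \<Longrightarrow> typed G t' A \<Longrightarrow> realizes A G t' v"
proof (induction A arbitrary: G t t' v)
  case Iota
  then show ?case by (auto intro: e_sym e_trans)
next
  case (Arr A B)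
  have "\<exists>r. apply_val (vshifts w v) a r \<and> realizes B D (App (shifts w t') u) r"
    if w: "wks w G D" and u: "realizes A D u a" for w D u a
  proof -
    from Arr.prems(1) w u obtain r where r: "apply_val (vshifts w v) a r"
      "realizes B D (App (shifts w t) u) r" by fastforce
    have "eqv D (App (shifts w t) u) (App (shifts w t') u) B"
      by (rule e_app[OF eqv_wks[OF Arr.prems(2) w] e_refl[OF realizes_typed[OF u]]])
    moreover have "typed D (App (shifts w t') u) B"
      by (rule t_app[OF typed_wks[OF Arr.prems(3) w] realizes_typed[OF u]])
    ultimately show ?thesis using Arr.IH(2) r by blast
  qed
  with Arr.prems(3) show ?case by simp
next
  case (Box A)
  have "eqv (Lock # G) (Unbox t 0) (Unbox t' 0) A" "typed (Lock # G) (Unbox t' 0) A"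
    using Box.prems by (auto intro: e_unbox t_unbox)
  with Box show ?case by fastforce
qed

lemma realizes_wk:
  "realizes A G t v \<Longrightarrow> wk m c G D \<Longrightarrow> realizes A D (shift m c t) (vshift m c v)"
proof (induction A arbitrary: G D t v c)
  case Iota
  then show ?case by (auto intro: eqv_wk typed_wk)
next
  case (Arr A B)
  have "\<exists>r. apply_val (vshifts w (vshift m c v)) a r \<and> realizes B D' (App (shifts w (shift m c t)) u) r"
    if "wks w D D'" "realizes A D' u a" for w D' u a
  proof -
    have "wks ((m, c) # w) G D'" using that Arr.prems by auto
    with Arr.prems(1) that(2) show ?thesis
      unfolding realizes.simps by (metis fst_conv shifts.simps(2) snd_conv vshifts.simps(2))
  qed
  with typed_wk[OF realizes_typed[OF Arr.prems(1)] Arr.prems(2)] show ?case by simp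
next
  case (Box A)
  then obtain a where a: "v = VBox a" "realizes A (Lock # G) (Unbox t 0) a" by auto
  from Box.IH[OF a(2) wk_Suc[OF Box.prems(2)]] a
    typed_wk[OF realizes_typed[OF Box.prems(1)] Box.prems(2)]
  show ?case by simp
qed

text \<open>Readback of functions and boxes is justified by the eta laws followed by congruence.
  Reflection allows an equivalent term \<open>s\<close> because an argument is replaced by its
  readback, which is only equivalent to it.\<close>

lemma realizes_reify_reflect:
  "realizes A G t v \<Longrightarrow> \<exists>s. quote A v s \<and> eqv G t s A"
  "typed G t A \<Longrightarrow> eqv G t s A \<Longrightarrow> realizes A G t (reflect A s)"
proof (induction A arbitrary: G t v s)
  case Iota
  {
    case 1
    then show ?case by (auto intro: quote_Iota)
  next
    case 2
    then show ?case by simp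
  }
next
  case (Arr A B)
  {
    case 1
    have "typed (CTy A # G) (Var 0) A" by (simp add: t_var)
    then have "realizes A (CTy A # G) (Var 0) (reflect A (Var 0))"
      by (intro Arr.IH e_refl)
    moreover have "wks [(Suc 0, 0)] G (CTy A # G)" by (simp add: wk_CTy)
    ultimately obtain r where r: "apply_val (vshifts [(Suc 0, 0)] v) (reflect A (Var 0)) r"
      "realizes B (CTy A # G) (App (shifts [(Suc 0, 0)] t) (Var 0)) r"
      using 1 by (metis realizes.simps(2))
    from Arr.IH(3)[OF r(2)] obtain s where s: "quote B r s"
      "eqv (CTy A # G) (App (shift 1 0 t) (Var 0)) s B" by auto
    have "eqv G t (Lam A s) (Arr A B)"
      by (rule e_trans[OF e_eta[OF realizes_typed[OF 1]] e_lam[OF s(2)]])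
    with r(1) s(1) show ?case by (auto intro: quote_Arr)
  next
    case 2
    have "\<exists>r. apply_val (vshifts w (VNe A B s)) a r \<and> realizes B D (App (shifts w t) u) r"
      if w: "wks w G D" and u: "realizes A D u a" for w D u a
    proof -
      from Arr.IH(1)[OF u] obtain q where q: "quote A a q" "eqv D u q A" by blast
      have "realizes B D (App (shifts w t) u) (reflect B (App (shifts w s) q))"
        using typed_wks[OF 2(1) w] eqv_wks[OF 2(2) w] q realizes_typed[OF u]
        by (intro Arr.IH(4)) (blast intro: t_app e_app)+
      with q show ?thesis by (auto intro: apply_VNe)
    qed
    with 2(1) show ?case by simp
  }
next
  case (Box A)
  {
    case 1
    then obtain a where a: "v = VBox a" "realizes A (Lock # G) (Unbox t 0) a" by auto
    from Box.IH(1)[OF a(2)] obtain s where s: "quote A a s" "eqv (Lock # G) (Unbox t 0) s A" by blast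
    have "eqv G t (BoxI s) (Box A)"
      by (rule e_trans[OF e_boxeta[OF realizes_typed[OF 1]] e_box[OF s(2)]])
    with a s show ?case by (auto intro: quote_Box)
  next
    case 2
    then have "realizes A (Lock # G) (Unbox t 0) (reflect A (Unbox s 0))"
      by (intro Box.IH(2)) (auto intro: t_unbox e_unbox)
    with 2 show ?case by simp
  }
qed

section \<open>Substitutions realized by environments\<close>

fun realizes_ctx :: "ctx \<Rightarrow> ctx \<Rightarrow> sub \<Rightarrow> val \<Rightarrow> bool" where
  "realizes_ctx [] D s v \<longleftrightarrow> s = []"
| "realizes_ctx (CTy A # G) D s v \<longleftrightarrow>
    (\<exists>t s' a v'. s = STm t # s' \<and> v = VPair v' a \<and> realizes A D t a \<and> realizes_ctx G D s' v')"
| "realizes_ctx (Lock # G) D s v \<longleftrightarrow>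
    (\<exists>k s' v'. s = SLock k # s' \<and> v = VLock k v' \<and> lockext D k \<and>
      realizes_ctx G (drop (Suc k) D) s' v')"

lemma realizes_ctx_fits: "realizes_ctx G D s v \<Longrightarrow> fits G s"
  by (induction G D s v rule: realizes_ctx.induct) auto

lemma realizes_ctx_wk:
  "realizes_ctx G D s v \<Longrightarrow> wk m c D D' \<Longrightarrow> realizes_ctx G D' (sshift m c s) (vshift m c v)"
proof (induction G arbitrary: D D' s v c)
  case (Cons x G)
  show ?case
  proof (cases x)
    case (CTy A)
    with Cons show ?thesis by (auto intro: realizes_wk)
  next
    case Lock
    with Cons.prems obtain k s' v' where k: "s = SLock k # s'" "v = VLock k v'" "lockext D k"
      "realizes_ctx G (drop (Suc k) D) s' v'" by auto
    show ?thesis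
    proof (cases "c \<le> k")
      case True
      with lockext_wk_le[OF Cons.prems(2) k(3)] k Lock show ?thesis by auto
    next
      case False
      with lockext_wk_gt[OF Cons.prems(2) k(3)] k Lock Cons.IH show ?thesis by auto
    qed
  qed
qed simp

lemma realizes_ctx_wks:
  "realizes_ctx G D s v \<Longrightarrow> wks w D D' \<Longrightarrow> realizes_ctx G D' (sshifts w s) (vshifts w v)"
  by (induction w arbitrary: D s v) (auto intro: realizes_ctx_wk)

lemma realizes_ctx_id: "realizes_ctx G G (idsub G) (idval G)"
  by (induction G rule: octx.induct)
    (auto intro!: realizes_ctx_wk[OF _ wk_CTy] realizes_reify_reflect(2) e_refl t_var)

lemma eval_var_prog:
  "lookup G n = Some A \<Longrightarrow> realizes_ctx G D s v \<Longrightarrow>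
    \<exists>r. eval (var_prog n) v r \<and> realizes A D (sub_var s n) r"
  by (induction G n arbitrary: s v rule: lookup.induct)
    (fastforce intro: eval_apply_val_quote.intros)+

text \<open>The \<open>k\<close> projections strip the entries above the lock and expose its
  \<open>VLock\<close>, whose position is the one that \<open>s\<close> assigns to this
  lock.\<close>

lemma eval_ext_prog:
  "lockext G k \<Longrightarrow> realizes_ctx G D s v \<Longrightarrow>
    \<exists>v'. eval (ext_prog k) v (VLock (sub_lock s k) v') \<and> lockext D (sub_lock s k) \<and>
      realizes_ctx (drop (Suc k) G) (drop (Suc (sub_lock s k)) D) (drop (Suc k) s) v'"
proof (induction k arbitrary: G s v)
  case 0
  then show ?case by (fastforce elim!: lockext_0E intro: eval_PId)
next
  case (Suc k)
  then obtain A H where "G = CTy A # H" "lockext H k" by (blast elim: lockext_SucE)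
  with Suc.IH[of H] Suc.prems show ?case by (fastforce intro: eval_PComp eval_PFst)
qed

text \<open>The beta laws enter here: a realized abstraction or box is tested by a redex, equivalent
  to the substituted body handled by the induction hypothesis.\<close>

lemma fundamental:
  "typed G t A \<Longrightarrow> realizes_ctx G D s v \<Longrightarrow>
    \<exists>r. eval (tm_prog t) v r \<and> realizes A D (psub s t) r"
proof (induction arbitrary: D s v rule: typed.induct)
  case (t_var G n A)
  then show ?case by (simp add: eval_var_prog)
next
  case (t_lam A G t B)
  let ?body = "\<lambda>s. psub (STm (Var 0) # sshift (Suc 0) 0 s) t"
  \<comment> \<open>Typing of the substituted body comes from the induction hypothesis at a fresh
    variable, since realized terms are typed.\<close>
  have body: "typed (CTy A # D') (?body s') B" if s': "realizes_ctx G D' s' v'" for D' s' v'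
  proof -
    have "realizes A (CTy A # D') (Var 0) (reflect A (Var 0))"
      by (intro realizes_reify_reflect(2) e_refl t_var) simp_all
    with realizes_ctx_wk[OF s' wk_CTy]
    have "realizes_ctx (CTy A # G) (CTy A # D') (STm (Var 0) # sshift (Suc 0) 0 s')
        (VPair (vshift (Suc 0) 0 v') (reflect A (Var 0)))" by auto
    from t_lam.IH[OF this] show ?thesis using realizes_typed by blast
  qed
  have "\<exists>r. apply_val (vshifts w (VClo (tm_prog t) v)) a r \<and>
      realizes B D' (App (shifts w (psub s (Lam A t))) u) r"
    if w: "wks w D D'" and u: "realizes A D' u a" for w D' u a
  proof -
    note s' = realizes_ctx_wks[OF t_lam.prems w]
    from s' u have "realizes_ctx (CTy A # G) D' (STm u # sshifts w s) (VPair (vshifts w v) a)" by auto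
    from t_lam.IH[OF this] obtain r where r: "eval (tm_prog t) (VPair (vshifts w v) a) r"
      "realizes B D' (psub (STm u # sshifts w s) t) r" by blast
    \<comment> \<open>Weakening the abstraction amounts to weakening the substitution, which exposes
      a beta redex.\<close>
    have app: "App (shifts w (psub s (Lam A t))) u = App (Lam A (?body (sshifts w s))) u"
      using shifts_psub[OF typed.t_lam[OF t_lam.hyps] realizes_ctx_fits[OF t_lam.prems]] by simp
    have "eqv D' (App (Lam A (?body (sshifts w s))) u) (psub (STm u # sshifts w s) t) B"
      using e_beta[OF body[OF s'] realizes_typed[OF u]]
        subst_psub_lift[OF t_lam.hyps realizes_ctx_fits[OF s']] by simp
    moreover have "typed D' (App (Lam A (?body (sshifts w s))) u) B"
      by (rule t_app[OF typed.t_lam[OF body[OF s']] realizes_typed[OF u]])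
    ultimately have "realizes B D' (App (shifts w (psub s (Lam A t))) u) r"
      unfolding app using realizes_eqv[OF r(2)] e_sym by blast
    with r(1) show ?thesis by (auto intro: apply_VClo)
  qed
  moreover have "typed D (psub s (Lam A t)) (Arr A B)"
    using typed.t_lam[OF body[OF t_lam.prems]] by simp
  ultimately have "realizes (Arr A B) D (psub s (Lam A t)) (VClo (tm_prog t) v)"
    unfolding realizes.simps by blast
  then show ?case by (metis eval_PCurry tm_prog.simps(2))
next
  case (t_app G t A B u)
  from t_app.IH(1)[OF t_app.prems] obtain h where h: "eval (tm_prog t) v h"
    "realizes (Arr A B) D (psub s t) h" by blast
  from t_app.IH(2)[OF t_app.prems] obtain a where a: "eval (tm_prog u) v a"
    "realizes A D (psub s u) a" by blast
  from h(2) a(2) obtain r where "apply_val (vshifts [] h) a r"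
    "realizes B D (App (shifts [] (psub s t)) (psub s u)) r"
    unfolding realizes.simps by (metis wks.simps(1))
  with h(1) a(1) show ?case by (auto intro: eval_PComp eval_PPair eval_PEv)
next
  case (t_box G t A)
  then have "realizes_ctx (Lock # G) (Lock # D) (SLock 0 # s) (VLock 0 v)" by simp
  from t_box.IH[OF this] obtain r where r: "eval (tm_prog t) (VLock 0 v) r"
    "realizes A (Lock # D) (psub (SLock 0 # s) t) r" by blast
  note ty = realizes_typed[OF r(2)]
  have "eqv (Lock # D) (Unbox (BoxI (psub (SLock 0 # s) t)) 0) (psub (SLock 0 # s) t) A"
    using e_boxbeta[of "Lock # D" 0 "psub (SLock 0 # s) t" A] ty by simp
  moreover have "typed (Lock # D) (Unbox (BoxI (psub (SLock 0 # s) t)) 0) A"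
    using ty by (auto intro!: t_unbox typed.t_box)
  ultimately have "realizes A (Lock # D) (Unbox (BoxI (psub (SLock 0 # s) t)) 0) r"
    using realizes_eqv[OF r(2)] e_sym by blast
  with ty have "realizes (Box A) D (psub s (BoxI t)) (VBox r)" by (simp add: typed.t_box)
  moreover have "eval (tm_prog (BoxI t)) v (VBox r)"
    using r(1) by (auto intro: eval_PComp eval_PUnit eval_PBox)
  ultimately show ?case by blast
next
  case (t_unbox G k t A)
  let ?j = "sub_lock s k"
  from eval_ext_prog[OF t_unbox.hyps(1) t_unbox.prems] obtain v' where v':
    "eval (ext_prog k) v (VLock ?j v')" "lockext D ?j"
    "realizes_ctx (drop (Suc k) G) (drop (Suc ?j) D) (drop (Suc k) s) v'" by blast
  from t_unbox.IH[OF v'(3)] obtain a where a: "eval (tm_prog t) v' (VBox a)"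
    "realizes A (Lock # drop (Suc ?j) D) (Unbox (psub (drop (Suc k) s) t) 0) a" by auto
  \<comment> \<open>Shifting \<open>Unbox _ 0\<close> by \<open>?j\<close> at position 0 gives
    \<open>Unbox _ ?j\<close>, while the counit shifts the value likewise.\<close>
  from realizes_wk[OF a(2) wk_lockext[OF v'(2)]]
  have "realizes A D (psub s (Unbox t k)) (vshift ?j 0 a)" by simp
  moreover have "eval (tm_prog (Unbox t k)) v (vshift ?j 0 a)"
    using v'(1) a(1) by (auto intro: eval_PComp eval_PLock eval_PCounit)
  ultimately show ?case by blast
qed

text \<open>The identity substitution leaves \<open>t\<close> unchanged, so
  \<open>fundamental\<close> relates \<open>t\<close> itself to its value at
  \<open>idval G\<close>.\<close>

lemma eval_id_quote:
  assumes "typed G t A"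
  shows "\<exists>r s. eval (tm_prog t) (idval G) r \<and> quote A r s \<and> eqv G t s A"
  using fundamental[OF assms realizes_ctx_id] realizes_reify_reflect(1) psub_idsub[OF assms]
  by metis

theorem theorem5:
  fixes G :: ctx and t u :: tm and A :: ty
  assumes "typed G t A" and "typed G u A"
    and "\<forall>(M :: (nat, nat) cccadj) (b :: nat). is_cccadj M \<longrightarrow> b \<in> c_ob M \<longrightarrow>
           itm M b G t = itm M b G u"
  shows "eqv G t u A"
proof -
  \<comment> \<open>The hypothesis is instantiated at the single countable model, with the base type
    denoting terms modulo \<open>eqv\<close>.\<close>
  have "itm term_model base_ob G t = itm term_model base_ob G u"
    using assms(3) is_cccadj_term_model by simp
  then have "eqp (octx G) (oty A) (tm_prog t) (tm_prog u)"
    using itm_term_model[OF assms(1)] itm_term_model[OF assms(2)] arrow_eqD by simp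
  from eqpD[OF this rel_idval] obtain r r' where r: "eval (tm_prog t) (idval G) r"
    "eval (tm_prog u) (idval G) r'" "rel (oty A) G r r'" by blast
  from rel_reify_reflect(1)[OF r(3)] obtain s s' where s: "quote A r s" "quote A r' s'" "eqv G s s' A"
    by blast
  \<comment> \<open>Determinism identifies the values and readbacks from
    \<open>eval_id_quote\<close> with those already obtained.\<close>
  have "eqv G t s A" "eqv G u s' A"
    using eval_id_quote[OF assms(1)] eval_id_quote[OF assms(2)] r s eval_deterministic(1,3) by metis+
  with s(3) show ?thesis by (meson e_sym e_trans)
qed

end
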